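(* Let $\mathbb{H}=\mathbb{F}^S$, let $\xi=H(T,X_T,S_T)\in L^2(\mathcal{F}_T,\mathbf{P})$ with $H(t,x,s)$ a deterministic function, and let ${}^o\xi=\mathbb{E}[\xi|\mathcal{H}_T]=\pi_T(H)$, where $\pi$ is the filter. Assume that $(X,S,\pi)$ is an $(\mathbb{F},\mathbf{P}^* )$-Markov process. Then the process $V^{\mathcal H}_t:=\mathbb{E}^{\mathbf{P}^*}[{}^o\xi\,|\,\mathcal{H}_t]$ admits the representation $$V^{\mathcal H}_t=\mathbb{E}^{\mathbf{P}^*}\bigl[g(t,X_t,S_t,\pi_t)\,\big|\,\mathcal{H}_t\bigr],\quad t\in[0,T],$$ where $g(t,x,s,p)$ is a measurable function on $[0,T]\times\mathbb{R}^2\times\mathcal{P}(\mathbb{R})$ such that $$g(t,X_t,S_t,\pi_t)=\mathbb{E}^{\mathbf{P}^*}\bigl[\pi_T(H)\,\big|\,\mathcal{F}_t\bigr],\quad t\in[0,T].$$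
   Context: $T>0$ is fixed; $(\Omega,\mathcal{F},\mathbf{P})$ is a probability space with filtration $\mathbb{F}=\{\mathcal{F}_t\}_{t\in[0,T]}$, $\mathcal{F}=\mathcal{F}_T$. $S$ is a real-valued square integrable càdlàg $(\mathbb{F},\mathbf{P})$-semimartingale satisfying the structure condition $S_t=S_0+M_t+\int_0^t\alpha^{\mathcal F}_u\,\mathrm{d}\langle M\rangle_u$, with $M$ a square integrable $(\mathbb{F},\mathbf{P})$-martingale, $M_0=0$, and $\alpha^{\mathcal F}$ $\mathbb{F}$-predictable with $\mathbb{E}[\int_0^T(\alpha^{\mathcal F}_s)^2\,\mathrm{d}\langle M\rangle_s]<\infty$. $X$ is a real-valued (unobservable) Markov process such that $(X,S)$ is an $(\mathbb{F},\mathbf{P})$-Markov process. $\mathbb{F}^S$ is the natural filtration of $S$ and $\mathbb{H}=\mathbb{F}^S$, i.e. $\mathcal{H}_t=\mathcal{F}^S_t$. All filtrations satisfy the usual conditions. Further standing assumptions: there is a deterministic $\rho:\mathbb{R}_+\to\mathbb{R}_+$ with $\rho(0^+)=0$ and $\langle M\rangle_t-\langle M\rangle_s\le\rho(t-s)$ for all $0\le s\le t\le T$, $\mathbf{P}$-a.s.; $|\alpha^{\mathcal F}_t|\le kS_t$ $(\mathbf{P}\otimes\langle M\rangle)$-a.e. for a constant $k\ge0$; $1-\alpha^{\mathcal F}_t\Delta M_t>0$ $\mathbf{P}$-a.s. for all $t$; $\mathbb{E}[\exp\{\frac12\int_0^T(\alpha^{\mathcal F}_t)^2\mathrm{d}\langle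 M^c\rangle_t+\int_0^T(\alpha^{\mathcal F}_t)^2\mathrm{d}\langle M^d\rangle_t\}]<\infty$, with $M^c,M^d$ the continuous and discontinuous parts of $M$; $L_t=\mathcal{E}(-\int\alpha^{\mathcal F}_u\mathrm{d}M_u)_t$ (Doléans-Dade exponential) is square integrable. The minimal martingale measure $\mathbf{P}^*$ is defined by $\mathrm{d}\mathbf{P}^*/\mathrm{d}\mathbf{P}|_{\mathcal{F}_t}=L_t$. Also ${}^o\xi\in L^2(\mathcal{H}_T,\mathbf{P}^* )$ and $S_t\in L^2(\mathcal{H}_t,\mathbf{P}^* )$ for each $t$. $\mathcal{P}(\mathbb{R})$ is the space of probability measures on $\mathbb{R}$ with the weak topology. The filter $\pi$ (under $\mathbf{P}$) is the $\mathcal{P}(\mathbb{R})$-valued process giving the conditional law of $X_t$ given $\mathcal{F}^S_t$: $\pi_t(f)=\mathbb{E}[f(t,X_t,S_t)|\mathcal{F}^S_t]=\int_{\mathbb{R}}f(t,x,S_t)\,\pi_t(\mathrm{d}x)$ for every measurable $f(t,x,s)$ with $\mathbb{E}|f(t,X_t,S_t)|<\infty$ for all $t$. In particular $\pi_T(H)=\int_{\mathbb{R}}H(T,x,S_T)\,\pi_T(\mathrm{d}x)$.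
   Formalization: The processes X and π are assumed jointly measurable in (t,ω); without this for X a jointly measurable g need not exist (e.g. X_t = h(t)Y with h non-measurable). *)

theory Defs
  imports "HOL-Probability.Probability"
begin

text \<open>
  Time runs through \<open>{0..T}\<close>; processes and filtrations are functions on all of \<open>real\<close> whose
  values outside \<open>{0..T}\<close> are irrelevant.  A process is a function of time and state, in this order.
\<close>

section \<open>Probability measures on the real line\<close>

definition weak_topology :: "real measure topology" where
  "weak_topology = topology_generated_by
     {{p \<in> space (prob_algebra borel). (\<integral>x. f x \<partial>p) \<in> U} | (f :: real \<Rightarrow> real) U.
        continuous_on UNIV f \<and> bounded (range f) \<and> open U}"

definition weak_borel :: "real measure measure" where
  "weak_borel = sigma (topspace weak_topology) {U. openin weak_topology U}"


section \<open>Filtrations and processes\<close>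

definition filtration_on :: "real \<Rightarrow> 'a measure \<Rightarrow> (real \<Rightarrow> 'a measure) \<Rightarrow> bool" where
  "filtration_on T P F \<longleftrightarrow>
     (\<forall>t\<in>{0..T}. subalgebra P (F t)) \<and>
     (\<forall>s\<in>{0..T}. \<forall>t\<in>{s..T}. sets (F s) \<subseteq> sets (F t))"

definition usual_conditions :: "real \<Rightarrow> 'a measure \<Rightarrow> (real \<Rightarrow> 'a measure) \<Rightarrow> bool" where
  "usual_conditions T P F \<longleftrightarrow>
     filtration_on T P F \<and>
     (\<forall>N\<in>null_sets P. \<forall>B. B \<subseteq> N \<longrightarrow> B \<in> sets (F 0)) \<and>
     (\<forall>t\<in>{0..<T}. sets (F t) = (\<Inter>u\<in>{t<..T}. sets (F u)))"

definition natural_filtration ::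
    "'a measure \<Rightarrow> 'b measure \<Rightarrow> (real \<Rightarrow> 'a \<Rightarrow> 'b) \<Rightarrow> real \<Rightarrow> 'a measure" where
  "natural_filtration P E Z t =
     sigma (space P) {Z s -` B \<inter> space P | s B. s \<in> {0..t} \<and> B \<in> sets E}"

text \<open>The smallest filtration containing \<open>G\<close> that satisfies the usual conditions.\<close>

definition usual_augmentation ::
    "real \<Rightarrow> 'a measure \<Rightarrow> (real \<Rightarrow> 'a measure) \<Rightarrow> real \<Rightarrow> 'a measure" where
  "usual_augmentation T P G t =
     sigma (space P)
       (\<Inter>u\<in>(if t < T then {t<..T} else {T}).
          sigma_sets (space P) (sets (G u) \<union> {B. \<exists>N\<in>null_sets P. B \<subseteq> N}))"

definition adapted :: "real \<Rightarrow> (real \<Rightarrow> 'a measure) \<Rightarrow> 'b measure \<Rightarrow> (real \<Rightarrow> 'a \<Rightarrow> 'b) \<Rightarrow> bool" where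
  "adapted T F E Z \<longleftrightarrow> (\<forall>t\<in>{0..T}. Z t \<in> F t \<rightarrow>\<^sub>M E)"

definition measurable_process ::
    "real \<Rightarrow> 'a measure \<Rightarrow> 'b measure \<Rightarrow> (real \<Rightarrow> 'a \<Rightarrow> 'b) \<Rightarrow> bool" where
  "measurable_process T P E Z \<longleftrightarrow>
     (\<lambda>(t, \<omega>). Z t \<omega>) \<in> restrict_space borel {0..T} \<Otimes>\<^sub>M P \<rightarrow>\<^sub>M E"

definition predictable_sigma :: "real \<Rightarrow> 'a measure \<Rightarrow> (real \<Rightarrow> 'a measure) \<Rightarrow> (real \<times> 'a) measure" where
  "predictable_sigma T P F =
     sigma ({0..T} \<times> space P)
       ({{0} \<times> A | A. A \<in> sets (F 0)} \<union>
        {{s<..t} \<times> A | s t A. 0 \<le> s \<and> s \<le> t \<and> t \<le> T \<and> A \<in> sets (F s)})"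

definition predictable ::
    "real \<Rightarrow> 'a measure \<Rightarrow> (real \<Rightarrow> 'a measure) \<Rightarrow> (real \<Rightarrow> 'a \<Rightarrow> real) \<Rightarrow> bool" where
  "predictable T P F Z \<longleftrightarrow> (\<lambda>(t, \<omega>). Z t \<omega>) \<in> borel_measurable (predictable_sigma T P F)"

definition cadlag :: "real \<Rightarrow> 'a measure \<Rightarrow> (real \<Rightarrow> 'a \<Rightarrow> real) \<Rightarrow> bool" where
  "cadlag T P Z \<longleftrightarrow>
     (\<forall>\<omega>\<in>space P.
        (\<forall>t\<in>{0..<T}. ((\<lambda>s. Z s \<omega>) \<longlongrightarrow> Z t \<omega>) (at_right t)) \<and>
        (\<forall>t\<in>{0<..T}. \<exists>l. ((\<lambda>s. Z s \<omega>) \<longlongrightarrow> l) (at_left t)))"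

definition left_limit :: "(real \<Rightarrow> 'a \<Rightarrow> real) \<Rightarrow> real \<Rightarrow> 'a \<Rightarrow> real" where
  "left_limit Z t \<omega> = (if t = 0 then Z 0 \<omega> else Lim (at_left t) (\<lambda>s. Z s \<omega>))"

definition jump :: "(real \<Rightarrow> 'a \<Rightarrow> real) \<Rightarrow> real \<Rightarrow> 'a \<Rightarrow> real" where
  "jump Z t \<omega> = Z t \<omega> - left_limit Z t \<omega>"

text \<open>
  The Markov property relative to a filtration: given the past, the law of a later state depends on
  the present state only.
\<close>

definition markov_process ::
    "real \<Rightarrow> 'a measure \<Rightarrow> (real \<Rightarrow> 'a measure) \<Rightarrow> 'b measure \<Rightarrow> (real \<Rightarrow> 'a \<Rightarrow> 'b) \<Rightarrow> bool" where
  "markov_process T P F E Z \<longleftrightarrow>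
     adapted T F E Z \<and>
     (\<forall>s\<in>{0..T}. \<forall>t\<in>{s..T}. \<forall>f\<in>borel_measurable E. bounded (f ` space E) \<longrightarrow>
        (AE \<omega> in P. real_cond_exp P (F s) (\<lambda>\<omega>. f (Z t \<omega>)) \<omega>
                  = real_cond_exp P (vimage_algebra (space P) (Z s) E) (\<lambda>\<omega>. f (Z t \<omega>)) \<omega>))"


section \<open>Martingales and semimartingales\<close>

definition martingale ::
    "real \<Rightarrow> 'a measure \<Rightarrow> (real \<Rightarrow> 'a measure) \<Rightarrow> (real \<Rightarrow> 'a \<Rightarrow> real) \<Rightarrow> bool" where
  "martingale T P F Z \<longleftrightarrow>
     adapted T F borel Z \<and> cadlag T P Z \<and>
     (\<forall>t\<in>{0..T}. integrable P (Z t)) \<and>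
     (\<forall>s\<in>{0..T}. \<forall>t\<in>{s..T}. AE \<omega> in P. real_cond_exp P (F s) (Z t) \<omega> = Z s \<omega>)"

definition square_integrable_process :: "real \<Rightarrow> 'a measure \<Rightarrow> (real \<Rightarrow> 'a \<Rightarrow> real) \<Rightarrow> bool" where
  "square_integrable_process T P Z \<longleftrightarrow>
     (\<forall>t\<in>{0..T}. Z t \<in> borel_measurable P \<and> integrable P (\<lambda>\<omega>. (Z t \<omega>)\<^sup>2))"

definition square_integrable_martingale ::
    "real \<Rightarrow> 'a measure \<Rightarrow> (real \<Rightarrow> 'a measure) \<Rightarrow> (real \<Rightarrow> 'a \<Rightarrow> real) \<Rightarrow> bool" where
  "square_integrable_martingale T P F Z \<longleftrightarrow> martingale T P F Z \<and> square_integrable_process T P Z"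

text \<open>On a finite horizon a localizing sequence eventually reaches \<open>T\<close>, not only converges to it.\<close>

definition localizing_sequence ::
    "real \<Rightarrow> 'a measure \<Rightarrow> (real \<Rightarrow> 'a measure) \<Rightarrow> (nat \<Rightarrow> 'a \<Rightarrow> real) \<Rightarrow> bool" where
  "localizing_sequence T P F \<tau> \<longleftrightarrow>
     (\<forall>n. \<forall>\<omega>\<in>space P. \<tau> n \<omega> \<in> {0..T} \<and> \<tau> n \<omega> \<le> \<tau> (Suc n) \<omega>) \<and>
     (\<forall>n. \<forall>t\<in>{0..T}. {\<omega>\<in>space P. \<tau> n \<omega> \<le> t} \<in> sets (F t)) \<and>
     (AE \<omega> in P. \<exists>n. \<tau> n \<omega> = T)"

definition stopped :: "('a \<Rightarrow> real) \<Rightarrow> (real \<Rightarrow> 'a \<Rightarrow> real) \<Rightarrow> real \<Rightarrow> 'a \<Rightarrow> real" where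
  "stopped \<tau> Z t \<omega> = Z (min t (\<tau> \<omega>)) \<omega>"

definition local_martingale ::
    "real \<Rightarrow> 'a measure \<Rightarrow> (real \<Rightarrow> 'a measure) \<Rightarrow> (real \<Rightarrow> 'a \<Rightarrow> real) \<Rightarrow> bool" where
  "local_martingale T P F Z \<longleftrightarrow>
     adapted T F borel Z \<and> cadlag T P Z \<and>
     (\<exists>\<tau>. localizing_sequence T P F \<tau> \<and>
          (\<forall>n. martingale T P F (stopped (\<tau> n) (\<lambda>t \<omega>. Z t \<omega> - Z 0 \<omega>))))"

definition increasing_process ::
    "real \<Rightarrow> 'a measure \<Rightarrow> (real \<Rightarrow> 'a measure) \<Rightarrow> (real \<Rightarrow> 'a \<Rightarrow> real) \<Rightarrow> bool" where
  "increasing_process T P F A \<longleftrightarrow>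
     adapted T F borel A \<and> cadlag T P A \<and>
     (\<forall>\<omega>\<in>space P. A 0 \<omega> = 0 \<and> mono_on {0..T} (\<lambda>t. A t \<omega>))"

text \<open>The finite variation part is written as a difference of two increasing processes.\<close>

definition semimartingale ::
    "real \<Rightarrow> 'a measure \<Rightarrow> (real \<Rightarrow> 'a measure) \<Rightarrow> (real \<Rightarrow> 'a \<Rightarrow> real) \<Rightarrow> bool" where
  "semimartingale T P F Z \<longleftrightarrow>
     adapted T F borel Z \<and> cadlag T P Z \<and>
     (\<exists>N B C. local_martingale T P F N \<and> increasing_process T P F B \<and> increasing_process T P F C \<and>
        (AE \<omega> in P. \<forall>t\<in>{0..T}. Z t \<omega> = Z 0 \<omega> + N t \<omega> + (B t \<omega> - C t \<omega>)))"

text \<open>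
  \<open>A\<close> is (a version of) the predictable quadratic variation \<open>\<langle>M\<rangle>\<close>: the predictable increasing
  process such that \<open>M\<^sup>2 - A\<close> is a martingale, which is unique up to indistinguishability.
\<close>

definition predictable_qv ::
    "real \<Rightarrow> 'a measure \<Rightarrow> (real \<Rightarrow> 'a measure) \<Rightarrow> (real \<Rightarrow> 'a \<Rightarrow> real) \<Rightarrow> (real \<Rightarrow> 'a \<Rightarrow> real) \<Rightarrow> bool"
  where
  "predictable_qv T P F M A \<longleftrightarrow>
     predictable T P F A \<and> increasing_process T P F A \<and>
     martingale T P F (\<lambda>t \<omega>. (M t \<omega>)\<^sup>2 - A t \<omega>)"

text \<open>
  The decomposition of a square integrable martingale with \<open>M\<^sub>0 = 0\<close> into its continuous and its
  purely discontinuous part; the latter is orthogonal to every continuous square integrable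
  martingale starting at \<open>0\<close>.
\<close>

definition continuous_martingale0 ::
    "real \<Rightarrow> 'a measure \<Rightarrow> (real \<Rightarrow> 'a measure) \<Rightarrow> (real \<Rightarrow> 'a \<Rightarrow> real) \<Rightarrow> bool" where
  "continuous_martingale0 T P F N \<longleftrightarrow>
     square_integrable_martingale T P F N \<and>
     (\<forall>\<omega>\<in>space P. N 0 \<omega> = 0 \<and> continuous_on {0..T} (\<lambda>t. N t \<omega>))"

definition martingale_decomposition ::
    "real \<Rightarrow> 'a measure \<Rightarrow> (real \<Rightarrow> 'a measure) \<Rightarrow> (real \<Rightarrow> 'a \<Rightarrow> real) \<Rightarrow>
     (real \<Rightarrow> 'a \<Rightarrow> real) \<Rightarrow> (real \<Rightarrow> 'a \<Rightarrow> real) \<Rightarrow> bool" where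
  "martingale_decomposition T P F M Mc Md \<longleftrightarrow>
     (AE \<omega> in P. \<forall>t\<in>{0..T}. M t \<omega> = Mc t \<omega> + Md t \<omega>) \<and>
     continuous_martingale0 T P F Mc \<and>
     square_integrable_martingale T P F Md \<and>
     (\<forall>N. continuous_martingale0 T P F N \<longrightarrow> martingale T P F (\<lambda>t \<omega>. Md t \<omega> * N t \<omega>))"


section \<open>Integration\<close>

text \<open>
  The Lebesgue--Stieltjes measure of a path of an increasing process; the path is continued
  constantly outside \<open>{0..T}\<close>, so that all mass lies in \<open>{0<..T}\<close>.
\<close>

definition path_measure :: "real \<Rightarrow> (real \<Rightarrow> 'a \<Rightarrow> real) \<Rightarrow> 'a \<Rightarrow> real measure" where
  "path_measure T A \<omega> = interval_measure (\<lambda>t. A (max 0 (min T t)) \<omega>)"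

text \<open>The measure \<open>P \<otimes> A\<close> on \<open>{0..T} \<times> \<Omega>\<close>.\<close>

definition doleans_measure :: "real \<Rightarrow> 'a measure \<Rightarrow> (real \<Rightarrow> 'a \<Rightarrow> real) \<Rightarrow> (real \<times> 'a) measure" where
  "doleans_measure T P A =
     measure_of ({0..T} \<times> space P) (sets (restrict_space borel {0..T} \<Otimes>\<^sub>M P))
       (\<lambda>B. \<integral>\<^sup>+ \<omega>. emeasure (path_measure T A \<omega>) {t. (t, \<omega>) \<in> B} \<partial>P)"

text \<open>
  Elementary integrands are finite sums of processes \<open>h \<cdot> 1\<^bsub>(s,t]\<^esub>\<close>, each given by a triple
  \<open>(s, t, h)\<close> with \<open>h\<close> bounded and \<open>\<F>\<^sub>s\<close>-measurable.
\<close>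

definition elementary_integrand ::
    "real \<Rightarrow> 'a measure \<Rightarrow> (real \<Rightarrow> 'a measure) \<Rightarrow> (real \<times> real \<times> ('a \<Rightarrow> real)) list \<Rightarrow> bool" where
  "elementary_integrand T P F K \<longleftrightarrow>
     (\<forall>(s, t, h) \<in> set K. 0 \<le> s \<and> s \<le> t \<and> t \<le> T \<and>
        h \<in> borel_measurable (F s) \<and> bounded (h ` space P))"

definition elementary_process ::
    "(real \<times> real \<times> ('a \<Rightarrow> real)) list \<Rightarrow> real \<Rightarrow> 'a \<Rightarrow> real" where
  "elementary_process K u \<omega> = (\<Sum>(s, t, h)\<leftarrow>K. h \<omega> * indicator {s<..t} u)"

definition elementary_integral ::
    "(real \<times> real \<times> ('a \<Rightarrow> real)) list \<Rightarrow> (real \<Rightarrow> 'a \<Rightarrow> real) \<Rightarrow> real \<Rightarrow> 'a \<Rightarrow> real" where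
  "elementary_integral K M u \<omega> = (\<Sum>(s, t, h)\<leftarrow>K. h \<omega> * (M (min t u) \<omega> - M (min s u) \<omega>))"

text \<open>
  \<open>I\<close> is the Ito integral \<open>\<integral> \<phi> dM\<close> of a predictable \<open>\<phi> \<in> L\<^sup>2(P \<otimes> A)\<close>, where \<open>A = \<langle>M\<rangle>\<close>: the
  square integrable martingale which is the limit of integrals of elementary integrands converging
  to \<open>\<phi>\<close> in \<open>L\<^sup>2(P \<otimes> A)\<close>.  By Doob's inequality convergence at time \<open>T\<close> is enough.
\<close>

definition ito_integral ::
    "real \<Rightarrow> 'a measure \<Rightarrow> (real \<Rightarrow> 'a measure) \<Rightarrow> (real \<Rightarrow> 'a \<Rightarrow> real) \<Rightarrow> (real \<Rightarrow> 'a \<Rightarrow> real) \<Rightarrow>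
     (real \<Rightarrow> 'a \<Rightarrow> real) \<Rightarrow> (real \<Rightarrow> 'a \<Rightarrow> real) \<Rightarrow> bool" where
  "ito_integral T P F M A \<phi> I \<longleftrightarrow>
     predictable T P F \<phi> \<and> square_integrable_martingale T P F I \<and>
     (\<exists>K. (\<forall>n. elementary_integrand T P F (K n)) \<and>
        (\<lambda>n. \<integral>\<^sup>+ \<omega>. (\<integral>\<^sup>+ t\<in>{0<..T}. ennreal ((elementary_process (K n) t \<omega> - \<phi> t \<omega>)\<^sup>2)
                 \<partial>path_measure T A \<omega>) \<partial>P) \<longlonglongrightarrow> 0 \<and>
        (\<lambda>n. \<integral>\<^sup>+ \<omega>. ennreal ((elementary_integral (K n) M T \<omega> - I T \<omega>)\<^sup>2) \<partial>P) \<longlonglongrightarrow> 0)"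

text \<open>The extension by localization to integrands that are only locally in \<open>L\<^sup>2(P \<otimes> A)\<close>.\<close>

definition local_ito_integral ::
    "real \<Rightarrow> 'a measure \<Rightarrow> (real \<Rightarrow> 'a measure) \<Rightarrow> (real \<Rightarrow> 'a \<Rightarrow> real) \<Rightarrow> (real \<Rightarrow> 'a \<Rightarrow> real) \<Rightarrow>
     (real \<Rightarrow> 'a \<Rightarrow> real) \<Rightarrow> (real \<Rightarrow> 'a \<Rightarrow> real) \<Rightarrow> bool" where
  "local_ito_integral T P F M A \<phi> I \<longleftrightarrow>
     (\<exists>\<tau>. localizing_sequence T P F \<tau> \<and>
        (\<forall>n. ito_integral T P F M A (\<lambda>t \<omega>. \<phi> t \<omega> * indicator {..\<tau> n \<omega>} t) (stopped (\<tau> n) I)))"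

text \<open>
  The Doleans-Dade exponential \<open>Z = \<E>(Y)\<close> of a square integrable martingale \<open>Y\<close> with \<open>Y\<^sub>0 = 0\<close>,
  i.e. the solution of \<open>Z\<^sub>t = 1 + \<integral>\<^sub>0\<^sup>t Z\<^bsub>u-\<^esub> dY\<^sub>u\<close>.
\<close>

definition doleans_dade_exponential ::
    "real \<Rightarrow> 'a measure \<Rightarrow> (real \<Rightarrow> 'a measure) \<Rightarrow> (real \<Rightarrow> 'a \<Rightarrow> real) \<Rightarrow> (real \<Rightarrow> 'a \<Rightarrow> real) \<Rightarrow> bool"
  where
  "doleans_dade_exponential T P F Y Z \<longleftrightarrow>
     adapted T F borel Z \<and> cadlag T P Z \<and> (AE \<omega> in P. Z 0 \<omega> = 1) \<and>
     (\<exists>A. predictable_qv T P F Y A \<and>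
        local_ito_integral T P F Y A (left_limit Z) (\<lambda>t \<omega>. Z t \<omega> - 1))"


section \<open>Change of measure and filter\<close>

definition density_process ::
    "real \<Rightarrow> 'a measure \<Rightarrow> (real \<Rightarrow> 'a measure) \<Rightarrow> 'a measure \<Rightarrow> (real \<Rightarrow> 'a \<Rightarrow> real) \<Rightarrow> bool" where
  "density_process T P F Q L \<longleftrightarrow>
     (\<forall>t\<in>{0..T}. restr_to_subalg Q (F t) =
        density (restr_to_subalg P (F t)) (\<lambda>\<omega>. ennreal (L t \<omega>)))"

text \<open>
  \<open>[0,T] \<times> \<real>\<^sup>2\<close>, the domain of functions of \<open>(t, x, s)\<close>, and \<open>[0,T] \<times> \<real>\<^sup>2 \<times> \<P>(\<real>)\<close>, the domain of
  functions of \<open>(t, x, s, p)\<close>.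
\<close>

abbreviation txs_space :: "real \<Rightarrow> (real \<times> real \<times> real) measure" where
  "txs_space T \<equiv> restrict_space borel {0..T} \<Otimes>\<^sub>M (borel \<Otimes>\<^sub>M borel)"

abbreviation txsp_space :: "real \<Rightarrow> (real \<times> real \<times> real \<times> real measure) measure" where
  "txsp_space T \<equiv> restrict_space borel {0..T} \<Otimes>\<^sub>M (borel \<Otimes>\<^sub>M (borel \<Otimes>\<^sub>M weak_borel))"

text \<open>\<open>\<pi>\<^sub>t(f) = \<integral> f(t, x, S\<^sub>t) \<pi>\<^sub>t(dx)\<close>.\<close>

definition filter_apply ::
    "(real \<Rightarrow> 'a \<Rightarrow> real) \<Rightarrow> (real \<Rightarrow> 'a \<Rightarrow> real measure) \<Rightarrow> (real \<times> real \<times> real \<Rightarrow> real) \<Rightarrow>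
     real \<Rightarrow> 'a \<Rightarrow> real" where
  "filter_apply S \<pi> f t \<omega> = (\<integral>x. f (t, x, S t \<omega>) \<partial>\<pi> t \<omega>)"

text \<open>
  \<open>\<pi>\<close> is the filter of the signal \<open>X\<close> with respect to the observation filtration \<open>G\<close> of \<open>S\<close>.
\<close>

definition filter_process ::
    "real \<Rightarrow> 'a measure \<Rightarrow> (real \<Rightarrow> 'a measure) \<Rightarrow> (real \<Rightarrow> 'a \<Rightarrow> real) \<Rightarrow> (real \<Rightarrow> 'a \<Rightarrow> real) \<Rightarrow>
     (real \<Rightarrow> 'a \<Rightarrow> real measure) \<Rightarrow> bool" where
  "filter_process T P G X S \<pi> \<longleftrightarrow>
     measurable_process T P weak_borel \<pi> \<and> adapted T G weak_borel \<pi> \<and>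
     (\<forall>f\<in>borel_measurable (txs_space T).
        (\<forall>t\<in>{0..T}. integrable P (\<lambda>\<omega>. f (t, X t \<omega>, S t \<omega>))) \<longrightarrow>
        (\<forall>t\<in>{0..T}. AE \<omega> in P.
           real_cond_exp P (G t) (\<lambda>\<omega>. f (t, X t \<omega>, S t \<omega>)) \<omega> = filter_apply S \<pi> f t \<omega>))"

end

theory Submission
  imports Defs
begin

text \<open>
  The second half is the tower property, once \<open>\<pi>\<^sub>T(H)\<close> is identified with \<open>E[\<xi> | \<F>\<^sup>S\<^sub>T]\<close> up to
  null sets (\<open>P\<^sup>*\<close> has a density with respect to \<open>P\<close>).  For the
  first half the Markov property turns \<open>E\<^sup>*[\<pi>\<^sub>T(H) | \<F>\<^sub>t]\<close> into \<open>E\<^sup>*[\<pi>\<^sub>T(H) | Z\<^sub>t]\<close> with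
  \<open>Z = (X, S, \<pi>)\<close>, which is a measurable function of \<open>Z\<^sub>t\<close> for each single \<open>t\<close>; the point is to make
  it jointly measurable in \<open>t\<close>.  This works because the state space of \<open>Z\<close> is countably generated
  (the weak topology on probability measures is second countable), so that one countable family
  of step functions is dense in \<open>L\<^sup>2\<close> of the law of every \<open>Z\<^sub>t\<close>, and because \<open>Z\<close> is jointly measurable.
\<close>

section \<open>The weak topology on probability measures\<close>

text \<open>Three obstacles shape the details. The weak topology is generated by all bounded
  continuous functions, which are not separable in the sup norm, so a countable subbase cannot come
  from uniform approximation. It comes from one-sided pointwise approximation: a nonnegative
  continuous function is approached from below by maxima of finitely many tents with rational
  parameters, and one-sided bounds for \<open>f\<close> and \<open>-f\<close> together control the
  integral of \<open>f\<close>. The selection of an approximation has to be explicit in t. Square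
  distance is the right criterion, because the distance to an unknown projection can be compared
  between candidates through the projected variable alone. The Markov property speaks of bounded
  functions of the later state, while \<pi>_T(H) is only square integrable under
  \<open>Pstar\<close>. It is therefore applied to truncations and carried over to the limit in
  L1.\<close>

definition tent :: "rat \<times> rat \<times> rat \<Rightarrow> real \<Rightarrow> real" where
  "tent c x = (case c of (q, r, s) \<Rightarrow> \<bar>of_rat q\<bar> * (1 - \<bar>of_rat r\<bar> * \<bar>x - of_rat s\<bar>))"

text \<open>Each \<open>tent\<close> is a peak of height |q| at s that falls with slope |q r|; the
  absolute values let every rational triple serve as an index. The final maximum with 0 cuts off the
  negative tails, so that finite maxima are bounded, and lists of triples keep the family
  countable.\<close>

fun tents :: "(rat \<times> rat \<times> rat) list \<Rightarrow> real \<Rightarrow> real" where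
  "tents [] x = 0"
| "tents (c # K) x = max (tent c x) (tents K x)"

lemma tents_nonneg: "0 \<le> tents K x"
  by (induction K) auto

lemma tent_le_tents: "c \<in> set K \<Longrightarrow> tent c x \<le> tents K x"
  by (induction K) auto

lemma tents_le: "(\<And>c. c \<in> set K \<Longrightarrow> tent c x \<le> u) \<Longrightarrow> 0 \<le> u \<Longrightarrow> tents K x \<le> u"
  by (induction K) auto

lemma continuous_tents: "continuous_on UNIV (tents K)"
proof (induction K)
  case (Cons c K)
  then have "continuous_on UNIV (\<lambda>x. max (tent c x) (tents K x))"
    unfolding tent_def by (cases c) (auto intro!: continuous_intros)
  then show ?case by simp
qed simp

lemma bounded_tents: "bounded (range (tents K))"
proof -
  have "\<exists>u\<ge>0. \<forall>x. tents K x \<le> u"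
  proof (induction K)
    case (Cons c K)
    then obtain u where u: "u \<ge> 0" "\<And>x. tents K x \<le> u" by auto
    obtain q r s where c: "c = (q, r, s)" by (cases c) auto
    have "tent c x \<le> \<bar>of_rat q\<bar>" for x
      unfolding tent_def c by (simp add: mult_left_le)
    with u have "tents (c # K) x \<le> max u \<bar>of_rat q\<bar>" for x
      by (metis tents.simps(2) max.mono max.commute)
    with u(1) show ?case by (intro exI[of _ "max u \<bar>of_rat q\<bar>"]) auto
  qed auto
  then obtain u where "\<And>x. tents K x \<le> u" by auto
  then show ?thesis
    unfolding bounded_iff using tents_nonneg[of K] by (auto intro!: exI[of _ u])
qed

text \<open>If \<open>f x < e\<close>, the zero tent will do. Otherwise \<open>f\<close> stays above
  \<open>f x - e / 2\<close> near \<open>x\<close>, and a tent of smaller height fits underneath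
  there if it is steep enough to be negative elsewhere and centred close enough to
  \<open>x\<close>.\<close>

lemma tent_below_continuous:
  fixes f :: "real \<Rightarrow> real"
  assumes f: "continuous_on UNIV f" "\<And>x. 0 \<le> f x" and e: "0 < e"
  obtains c where "\<And>y. tent c y \<le> f y" "f x - e < tent c x"
proof (cases "f x < e")
  case True
  then show ?thesis using f(2) by (intro that[of "(0, 0, 0)"]) (auto simp: tent_def)
next
  case False
  have "isCont f x" using f(1) by (simp add: continuous_on_eq_continuous_at)
  then obtain d where d: "d > 0" "\<And>y. \<bar>y - x\<bar> < d \<Longrightarrow> \<bar>f y - f x\<bar> < e / 2"
    using e unfolding continuous_at_eps_delta dist_real_def by (meson half_gt_zero)
  obtain q where q: "f x - e < of_rat q" "of_rat q < f x - e / 2"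
    using of_rat_dense[of "f x - e" "f x - e / 2"] e by auto
  \<comment> \<open>The tent vanishes at distance 1/r from its centre; \<open>r > 2 / d\<close>
    makes this less than d/2.\<close>
  obtain r where r: "2 / d < of_rat r" "of_rat r < 2 / d + 1"
    using of_rat_dense[of "2 / d" "2 / d + 1"] by auto
  have rpos: "(0::real) < of_rat r" using d(1) r(1) by (meson divide_pos_pos less_trans zero_less_numeral)
  have qpos: "(0::real) < of_rat q" using q(1) False by linarith
  \<comment> \<open>The first bound keeps points at distance at least d from \<open>x\<close> at
    distance at least d/2 from the centre; the second keeps the loss q r |x - s| at \<open>x\<close>
    below q - (f x - e).\<close>
  define h where "h = min (d / 2) ((of_rat q - (f x - e)) / (of_rat q * of_rat r))"
  have "h > 0" using d(1) q(1) rpos qpos by (auto simp: h_def)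
  then obtain s where s: "x < of_rat s" "of_rat s < x + h"
    using of_rat_dense[of x "x + h"] by auto
  have t: "tent (q, r, s) y = of_rat q * (1 - of_rat r * \<bar>y - of_rat s\<bar>)" for y
    using rpos qpos by (simp add: tent_def)
  show ?thesis
  proof (rule that[of "(q, r, s)"])
    fix y
    show "tent (q, r, s) y \<le> f y"
    proof (cases "\<bar>y - x\<bar> < d")
      case True
      have "tent (q, r, s) y \<le> of_rat q"
        unfolding t using rpos qpos by (simp add: mult_left_le)
      then show ?thesis using d(2)[OF True] q(2) by linarith
    next
      case False
      moreover have "of_rat s < x + d / 2" using s(2) by (simp add: h_def)
      ultimately have "d / 2 \<le> \<bar>y - of_rat s\<bar>" using s(1) by linarith
      then have "2 / d * (d / 2) \<le> of_rat r * \<bar>y - of_rat s\<bar>"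
        using r(1) d(1) rpos by (intro mult_mono) auto
      then have "1 - of_rat r * \<bar>y - of_rat s\<bar> \<le> 0" using d(1) by simp
      then have "tent (q, r, s) y \<le> 0" unfolding t using qpos by (simp add: mult_nonneg_nonpos)
      then show ?thesis using f(2)[of y] by simp
    qed
  next
    have "\<bar>x - of_rat s\<bar> < (of_rat q - (f x - e)) / (of_rat q * of_rat r)"
      using s by (simp add: h_def)
    then have "of_rat q * of_rat r * \<bar>x - of_rat s\<bar> < of_rat q - (f x - e)"
      using qpos rpos by (simp add: field_simps)
    then show "f x - e < tent (q, r, s) x" unfolding t by (simp add: algebra_simps)
  qed
qed

text \<open>The \<open>n\<close>-th list collects those tents with code below \<open>n\<close> that
  lie under \<open>f\<close>, so every tent supplied by \<open>tent_below_continuous\<close> is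
  included from some index on. Convergence is only pointwise, which is enough for dominated
  convergence.\<close>

lemma tents_approx:
  fixes f :: "real \<Rightarrow> real"
  assumes f: "continuous_on UNIV f" "\<And>x. 0 \<le> f x"
  obtains K where "\<And>n x. tents (K n) x \<le> f x" "\<And>x. (\<lambda>n. tents (K n) x) \<longlonglongrightarrow> f x"
proof -
  define K where "K n = filter (\<lambda>c. \<forall>x. tent c x \<le> f x) (map from_nat [0..<n])" for n
  have le: "tents (K n) x \<le> f x" for n x
    using f(2) by (intro tents_le) (auto simp: K_def)
  have "(\<lambda>n. tents (K n) x) \<longlonglongrightarrow> f x" for x
  proof (rule LIMSEQ_I)
    fix e :: real assume "0 < e"
    then obtain c where c: "\<And>y. tent c y \<le> f y" "f x - e < tent c x"
      using tent_below_continuous[OF f] by metis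
    have "norm (tents (K n) x - f x) < e" if "n \<ge> Suc (to_nat c)" for n
    proof -
      have "c \<in> set (K n)"
        using c(1) that by (auto simp: K_def image_iff intro!: bexI[of _ "to_nat c"])
      then have "f x - e < tents (K n) x"
        using tent_le_tents c(2) by (meson less_le_trans)
      then show ?thesis using le[of n x] by simp
    qed
    then show "\<exists>no. \<forall>n\<ge>no. norm (tents (K n) x - f x) < e" by blast
  qed
  with le that show ?thesis by blast
qed

section \<open>A countable subbase of the weak topology\<close>

lemma prob_algebra_borelD:
  assumes "p \<in> space (prob_algebra (borel :: real measure))"
  shows "prob_space p" "sets p = sets borel" "space p = UNIV"
  using assms sets_eq_imp_space_eq[of p borel] by (auto simp: space_prob_algebra)

lemma integrable_bounded_continuous:
  fixes f :: "real \<Rightarrow> real"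
  assumes p: "p \<in> space (prob_algebra borel)" and f: "continuous_on UNIV f" "bounded (range f)"
  shows "integrable p f"
proof -
  interpret prob_space p by (rule prob_algebra_borelD[OF p])
  obtain u where "\<And>x. norm (f x) \<le> u" using f(2) by (auto simp: bounded_iff)
  then show ?thesis
    using f(1) p by (intro integrable_const_bound[where B=u])
      (auto intro: borel_measurable_continuous_onI simp: measurable_cong_sets[OF prob_algebra_borelD(2)[OF p] refl])
qed

text \<open>The functional \<open>p \<mapsto> \<integral> f dp\<close> is a supremum of functionals \<open>p \<mapsto> \<integral> tents K dp\<close>, hence lower
  semicontinuous for the topology they generate; applied to \<open>u \<plusminus> f\<close> this yields continuity.\<close>

lemma integral_tents_approx:
  fixes f :: "real \<Rightarrow> real"
  assumes p: "p \<in> space (prob_algebra borel)"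
    and f: "continuous_on UNIV f" "bounded (range f)" "\<And>x. 0 \<le> f x" and e: "0 < e"
  obtains K where "\<And>x. tents K x \<le> f x" "(\<integral>x. f x \<partial>p) - e < (\<integral>x. tents K x \<partial>p)"
proof -
  obtain K where K: "\<And>n x. tents (K n) x \<le> f x" "\<And>x. (\<lambda>n. tents (K n) x) \<longlonglongrightarrow> f x"
    using tents_approx[OF f(1,3)] by metis
  have int: "integrable p f" "\<And>n. integrable p (tents (K n))"
    using integrable_bounded_continuous[OF p] f(1,2) continuous_tents bounded_tents by blast+
  have "(\<lambda>n. \<integral>x. tents (K n) x \<partial>p) \<longlonglongrightarrow> (\<integral>x. f x \<partial>p)"
    using int K tents_nonneg by (intro integral_dominated_convergence[where w=f]) auto
  then have "eventually (\<lambda>n. (\<integral>x. f x \<partial>p) - e < (\<integral>x. tents (K n) x \<partial>p)) sequentially"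
    using e by (intro order_tendstoD(1)) auto
  then show ?thesis using that K(1) by (auto simp: eventually_sequentially)
qed

text \<open>Only strict lower bounds on integrals occur: an upper bound on the integral of a
  function is a lower bound for its negative.\<close>

definition weak_subbase :: "real measure set set" where
  "weak_subbase = range (\<lambda>(K, q). {p \<in> space (prob_algebra borel). of_rat q < (\<integral>x. tents K x \<partial>p)})"

lemma countable_weak_subbase: "countable weak_subbase"
  unfolding weak_subbase_def by simp

lemma topspace_weak_topology: "topspace weak_topology = space (prob_algebra borel)"
proof -
  \<comment> \<open>The whole space is itself a generator, given by the zero function and the open
    set \<open>UNIV\<close>.\<close>
  have "space (prob_algebra borel) = {p \<in> space (prob_algebra borel). (\<integral>x. (0::real) \<partial>(p :: real measure)) \<in> UNIV}"
    by simp
  then show ?thesis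
    unfolding weak_topology_def topology_generated_by_topspace
    by (fastforce intro!: exI[of _ "\<lambda>_. 0 :: real"] exI[of _ UNIV])
qed

lemma space_weak_borel: "space weak_borel = space (prob_algebra borel)"
  unfolding weak_borel_def topspace_weak_topology by (simp add: space_measure_of_conv)

lemma sets_weak_borel_eq:
  "sets weak_borel = sigma_sets (space (prob_algebra borel)) {U. openin weak_topology U}"
  unfolding weak_borel_def using openin_subset[of weak_topology]
  by (subst sets_measure_of) (auto simp: topspace_weak_topology)

lemma openin_weak_integral:
  fixes f :: "real \<Rightarrow> real"
  assumes "continuous_on UNIV f" "bounded (range f)" "open U"
  shows "openin weak_topology {p \<in> space (prob_algebra borel). (\<integral>x. f x \<partial>p) \<in> U}"
  unfolding weak_topology_def using assms by (intro topology_generated_by_Basis) blast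

text \<open>Induction over the generation of open sets; only a generator needs work. There two
  subbase sets suffice, \<open>B\<close> bounding the integral of \<open>f\<close> from below and
  \<open>C\<close> bounding it from above.\<close>

lemma weak_subbase_nhds:
  assumes "openin weak_topology U" "p \<in> U"
  shows "\<exists>F. finite F \<and> F \<subseteq> weak_subbase \<and> p \<in> space (prob_algebra borel) \<inter> \<Inter>F \<and>
    space (prob_algebra borel) \<inter> \<Inter>F \<subseteq> U"
  using openin_topology_generated_by[OF assms(1)[unfolded weak_topology_def]] assms(2)
proof (induction)
  case (Int U V)
  then obtain F G where "finite F" "F \<subseteq> weak_subbase" "p \<in> space (prob_algebra borel) \<inter> \<Inter>F"
      "space (prob_algebra borel) \<inter> \<Inter>F \<subseteq> U"
      "finite G" "G \<subseteq> weak_subbase" "p \<in> space (prob_algebra borel) \<inter> \<Inter>G"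
      "space (prob_algebra borel) \<inter> \<Inter>G \<subseteq> V" by auto
  then show ?case by (intro exI[of _ "F \<union> G"]) auto
next
  case (UN \<U>)
  then obtain U where U: "U \<in> \<U>" "p \<in> U" by auto
  from UN.IH[OF this] U(1) show ?case by (meson Union_upper subset_trans)
next
  case (Basis U)
  then obtain f V where U: "U = {p \<in> space (prob_algebra borel). (\<integral>x. f x \<partial>p) \<in> V}"
    and f: "continuous_on UNIV (f :: real \<Rightarrow> real)" "bounded (range f)" and V: "open V" by auto
  have p: "p \<in> space (prob_algebra borel)" "(\<integral>x. f x \<partial>p) \<in> V" using Basis(2) U by auto
  obtain e where e: "e > 0" "\<And>v. \<bar>v - (\<integral>x. f x \<partial>p)\<bar> < e \<Longrightarrow> v \<in> V"
    using V p(2) by (force simp: open_dist dist_real_def)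
  obtain u where u: "\<And>x. \<bar>f x\<bar> \<le> u"
    using f(2) unfolding bounded_iff by (metis rangeI real_norm_def)
  \<comment> \<open>One subbase set is enough: the rational \<open>q\<close> is placed between the
    integral of u + g less e and the integral of a tent maximum below u + g. Adding u makes the
    function nonnegative and shifts all integrals equally, as these are probability
    measures.\<close>
  have lsc: "\<exists>B\<in>weak_subbase. p \<in> B \<and> (\<forall>p'\<in>B. (\<integral>x. g x \<partial>p) - e < (\<integral>x. g x \<partial>p'))"
    if g: "continuous_on UNIV g" "\<And>x. \<bar>g x\<bar> \<le> u" for g :: "real \<Rightarrow> real"
  proof -
    have "norm (u + g x) \<le> 2 * u" for x using g(2)[of x] by (simp add: abs_le_iff)
    then have bg: "bounded (range g)" "bounded (range (\<lambda>x. u + g x))"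
      using g(2) by (auto intro!: boundedI)
    have cg: "continuous_on UNIV (\<lambda>x. u + g x)" using g(1) by (intro continuous_intros)
    have shift: "(\<integral>x. u + g x \<partial>p') = u + (\<integral>x. g x \<partial>p')" if "p' \<in> space (prob_algebra borel)" for p'
    proof -
      interpret prob_space p' by (rule prob_algebra_borelD[OF that])
      show ?thesis using integrable_bounded_continuous[OF that g(1) bg(1)] by (simp add: prob_space)
    qed
    have ge: "0 \<le> u + g x" for x using g(2)[of x] by linarith
    obtain K where K: "\<And>x. tents K x \<le> u + g x" "(\<integral>x. u + g x \<partial>p) - e < (\<integral>x. tents K x \<partial>p)"
      using integral_tents_approx[OF p(1) cg bg(2) ge e(1)] by metis
    obtain q where q: "(\<integral>x. u + g x \<partial>p) - e < of_rat q" "of_rat q < (\<integral>x. tents K x \<partial>p)"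
      using of_rat_dense[OF K(2)] by auto
    have "(\<integral>x. g x \<partial>p) - e < (\<integral>x. g x \<partial>p')"
      if p': "p' \<in> space (prob_algebra borel)" "of_rat q < (\<integral>x. tents K x \<partial>p')" for p'
    proof -
      have "(\<integral>x. tents K x \<partial>p') \<le> (\<integral>x. u + g x \<partial>p')"
        using K(1) by (intro integral_mono integrable_bounded_continuous p'(1) cg bg
          continuous_tents bounded_tents) auto
      then show ?thesis using q p' shift[OF p'(1)] shift[OF p(1)] by linarith
    qed
    then show ?thesis
      using p(1) q(2)
      by (intro bexI[of _ "{p \<in> space (prob_algebra borel). of_rat q < (\<integral>x. tents K x \<partial>p)}"])
         (auto simp: weak_subbase_def)
  qed
  obtain B where B: "B \<in> weak_subbase" "p \<in> B" "\<forall>p'\<in>B. (\<integral>x. f x \<partial>p) - e < (\<integral>x. f x \<partial>p')"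
    using lsc[OF f(1) u] by auto
  obtain C where C: "C \<in> weak_subbase" "p \<in> C" "\<forall>p'\<in>C. (\<integral>x. - f x \<partial>p) - e < (\<integral>x. - f x \<partial>p')"
    using lsc[of "\<lambda>x. - f x"] f(1) u by (auto intro: continuous_on_minus)
  have "p' \<in> U" if "p' \<in> space (prob_algebra borel) \<inter> \<Inter>{B, C}" for p'
  proof -
    have "(\<integral>x. f x \<partial>p) - e < (\<integral>x. f x \<partial>p')" "- (\<integral>x. f x \<partial>p) - e < - (\<integral>x. f x \<partial>p')"
      using that B(3) C(3) by auto
    then show ?thesis using e(2)[of "\<integral>x. f x \<partial>p'"] that U by auto
  qed
  then show ?case
    using B(1,2) C(1,2) p(1) by (intro exI[of _ "{B, C}"]) auto
qed simp

text \<open>A subbase of a topology need not generate its Borel sets. Here it does because it is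
  countable: it has only countably many finite subfamilies, so each open set is a countable union of
  finite intersections.\<close>

lemma sets_weak_borel: "sets weak_borel = sigma_sets (space (prob_algebra borel)) weak_subbase"
  unfolding sets_weak_borel_eq
proof (rule sigma_sets_eqI)
  let ?X = "space (prob_algebra borel) :: real measure set"
  fix U assume "U \<in> {U. openin weak_topology U}"
  then have U: "openin weak_topology U" by simp
  define \<F> where "\<F> = {F. (finite F \<and> F \<subseteq> weak_subbase) \<and> ?X \<inter> \<Inter>F \<subseteq> U}"
  have "countable \<F>"
    by (rule countable_subset[OF _ countable_Collect_finite_subset[OF countable_weak_subbase]])
       (auto simp: \<F>_def)
  moreover have "?X \<inter> \<Inter>F \<in> sigma_sets ?X weak_subbase" if F: "F \<in> \<F>" for F
  proof -
    have sub: "weak_subbase \<subseteq> Pow ?X" by (auto simp: weak_subbase_def)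
    interpret sigma_algebra ?X "sigma_sets ?X weak_subbase" by (rule sigma_algebra_sigma_sets[OF sub])
    from F have "finite F" "F \<subseteq> weak_subbase" by (auto simp: \<F>_def)
    then show ?thesis
    proof (induction F)
      case (insert B F)
      have "?X \<inter> \<Inter>(insert B F) = B \<inter> (?X \<inter> \<Inter>F)" by auto
      with insert show ?case by (auto intro!: Int)
    qed auto
  qed
  ultimately have "(\<Union>F\<in>\<F>. ?X \<inter> \<Inter>F) \<in> sigma_sets ?X weak_subbase"
    by (intro sigma_sets_UNION) auto
  moreover have "U = (\<Union>F\<in>\<F>. ?X \<inter> \<Inter>F)"
    using weak_subbase_nhds[OF U] by (fastforce simp: \<F>_def)
  ultimately show "U \<in> sigma_sets ?X weak_subbase" by simp
next
  fix B assume "B \<in> weak_subbase"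
  then obtain K q where B: "B = {p \<in> space (prob_algebra borel). (\<integral>x. tents K x \<partial>p) \<in> {of_rat q<..}}"
    by (auto simp: weak_subbase_def)
  show "B \<in> sigma_sets (space (prob_algebra borel)) {U. openin weak_topology U}"
    unfolding B by (intro sigma_sets.Basic CollectI openin_weak_integral continuous_tents bounded_tents) simp
qed

section \<open>Borel measurable functionals of a probability measure\<close>

lemma borel_measurable_weak_integral:
  fixes f :: "real \<Rightarrow> real"
  assumes "continuous_on UNIV f" "bounded (range f)"
  shows "(\<lambda>p. \<integral>x. f x \<partial>p) \<in> borel_measurable weak_borel"
proof (rule borel_measurableI)
  fix U :: "real set" assume "open U"
  then have "openin weak_topology {p \<in> space (prob_algebra borel). (\<integral>x. f x \<partial>p) \<in> U}"
    using openin_weak_integral assms by blast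
  moreover have "(\<lambda>p. \<integral>x. f x \<partial>p) -` U \<inter> space weak_borel =
      {p \<in> space (prob_algebra borel). (\<integral>x. f x \<partial>p) \<in> U}"
    by (auto simp: space_weak_borel)
  ultimately show "(\<lambda>p. \<integral>x. f x \<partial>p) -` U \<inter> space weak_borel \<in> sets weak_borel"
    by (simp add: sets_weak_borel_eq sigma_sets.Basic)
qed

text \<open>The half-lines form an intersection-stable generator, and the mass of a half-line is the
  limit of integrals of continuous ramps. This is what permits integrating the merely measurable
  \<open>H\<close> against the filter, although the weak topology only knows continuous
  integrands.\<close>

lemma measurable_weak_borel_prob_algebra: "(\<lambda>p. p) \<in> weak_borel \<rightarrow>\<^sub>M prob_algebra borel"
proof (rule measurable_prob_algebra_generated)
  show "sets (borel :: real measure) = sigma_sets UNIV (range atMost)"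
    by (subst borel_eq_atMost) simp
  show "Int_stable (range (atMost :: real \<Rightarrow> _))"
    by (auto simp: Int_stable_def)
next
  fix B :: "real set" assume "B \<in> range atMost"
  then obtain a where B: "B = {..a}" by auto
  define f where "f n = cts_step a (a + 1 / real (Suc n))" for n
  have cont: "continuous_on UNIV (f n)" for n
    unfolding f_def by (intro uniformly_continuous_imp_continuous cts_step_uniformly_continuous) simp
  have f01: "0 \<le> f n x" "f n x \<le> 1" for n x
    by (auto simp: f_def cts_step_def divide_simps)
  have bdd: "bounded (range (f n))" for n
    using f01 by (auto simp: bounded_iff intro!: exI[of _ 1])
  have lim: "(\<lambda>n. f n x) \<longlonglongrightarrow> indicator {..a} x" for x
  proof (cases "x \<le> a")
    case False
    then have "eventually (\<lambda>n. 1 / real (Suc n) < x - a) sequentially"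
      using LIMSEQ_Suc[OF lim_1_over_n] by (intro order_tendstoD(2)) auto
    then have "eventually (\<lambda>n. f n x = 0) sequentially"
      using False by (auto elim!: eventually_mono simp: f_def cts_step_def)
    then show ?thesis using False by (auto intro: tendsto_eventually)
  qed (auto simp: f_def cts_step_def)
  have conv: "(\<lambda>n. \<integral>x. f n x \<partial>p) \<longlonglongrightarrow> measure p B" if "p \<in> space weak_borel" for p
  proof -
    from that have p: "p \<in> space (prob_algebra borel)" by (simp add: space_weak_borel)
    interpret prob_space p by (rule prob_algebra_borelD[OF p])
    note [measurable_cong] = prob_algebra_borelD(2)[OF p]
    have "(\<lambda>n. \<integral>x. f n x \<partial>p) \<longlonglongrightarrow> (\<integral>x. indicator {..a} x \<partial>p)"
      using f01 lim by (intro integral_dominated_convergence[where w="\<lambda>_. 1"])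
        (auto intro: borel_measurable_integrable integrable_bounded_continuous[OF p cont bdd])
    then show ?thesis using prob_algebra_borelD(3)[OF p] by (simp add: B)
  qed
  have "(\<lambda>p. measure p B) \<in> borel_measurable weak_borel"
    by (rule borel_measurable_LIMSEQ_metric[OF borel_measurable_weak_integral[OF cont bdd] conv])
  then have "(\<lambda>p. ennreal (measure p B)) \<in> borel_measurable weak_borel" by measurable
  moreover have "emeasure p B = ennreal (measure p B)" if "p \<in> space weak_borel" for p
    using that prob_algebra_borelD(1)[of p]
    by (simp add: space_weak_borel finite_measure.emeasure_eq_measure prob_space.finite_measure)
  ultimately show "(\<lambda>p. emeasure p B) \<in> borel_measurable weak_borel"
    by (simp cong: measurable_cong)
qed (simp_all add: space_weak_borel prob_algebra_borelD(1,2))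

section \<open>Dense families in the space of square integrable functions\<close>

definition sq_integrable :: "'a measure \<Rightarrow> ('a \<Rightarrow> real) \<Rightarrow> bool" where
  "sq_integrable M f \<longleftrightarrow> f \<in> borel_measurable M \<and> integrable M (\<lambda>x. (f x)\<^sup>2)"

lemma sq_integrable_measurable [measurable_dest]: "sq_integrable M f \<Longrightarrow> f \<in> borel_measurable M"
  by (simp add: sq_integrable_def)

lemma sq_integrable_mult:
  assumes "sq_integrable M f" "sq_integrable M g"
  shows "integrable M (\<lambda>x. f x * g x)"
proof (rule Bochner_Integration.integrable_bound)
  show "integrable M (\<lambda>x. (f x)\<^sup>2 + (g x)\<^sup>2)"
    using assms by (auto simp: sq_integrable_def)
  show "(\<lambda>x. f x * g x) \<in> borel_measurable M"
    using assms by (auto simp: sq_integrable_def)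
  have "\<bar>a * b\<bar> \<le> a\<^sup>2 + b\<^sup>2" for a b :: real
  proof -
    have "0 \<le> (\<bar>a\<bar> - \<bar>b\<bar>)\<^sup>2" by simp
    then have "2 * \<bar>a * b\<bar> \<le> a\<^sup>2 + b\<^sup>2" by (simp add: power2_diff abs_mult)
    then show ?thesis by linarith
  qed
  then show "AE x in M. norm (f x * g x) \<le> norm ((f x)\<^sup>2 + (g x)\<^sup>2)" by auto
qed

lemma sq_integrable_add:
  assumes "sq_integrable M f" "sq_integrable M g"
  shows "sq_integrable M (\<lambda>x. f x + g x)"
proof -
  have "integrable M (\<lambda>x. (f x)\<^sup>2 + (g x)\<^sup>2 + 2 * (f x * g x))"
    using assms sq_integrable_mult[OF assms] by (auto simp: sq_integrable_def)
  then show ?thesis using assms by (auto simp: sq_integrable_def power2_sum mult.assoc)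
qed

lemma sq_integrable_cmult: "sq_integrable M f \<Longrightarrow> sq_integrable M (\<lambda>x. c * f x)"
  by (auto simp: sq_integrable_def power_mult_distrib)

lemma sq_integrable_diff:
  assumes "sq_integrable M f" "sq_integrable M g"
  shows "sq_integrable M (\<lambda>x. f x - g x)"
  using sq_integrable_add[OF assms(1) sq_integrable_cmult[OF assms(2), of "-1"]] by simp

lemma (in finite_measure) sq_integrable_bounded:
  assumes [measurable]: "f \<in> borel_measurable M" and "\<And>x. x \<in> space M \<Longrightarrow> \<bar>f x\<bar> \<le> c"
  shows "sq_integrable M f"
  unfolding sq_integrable_def
proof
  show "integrable M (\<lambda>x. (f x)\<^sup>2)"
    using assms(2) by (intro integrable_const_bound[where B="c\<^sup>2"])
      (auto intro!: AE_I2 simp: abs_le_square_iff[symmetric] intro: order_trans[OF _ abs_ge_self])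
qed simp

lemma (in finite_measure) sq_integrable_integrable:
  assumes "sq_integrable M f" shows "integrable M f"
  using sq_integrable_mult[OF assms sq_integrable_bounded[of "\<lambda>_. 1" 1]] by simp

text \<open>Stands in for the triangle inequality and avoids square roots; the factors 2 are the
  reason why errors are split into quarters below.\<close>

lemma integral_sq_dist_le:
  assumes "sq_integrable M f" "sq_integrable M g" "sq_integrable M h"
  shows "(\<integral>x. (f x - h x)\<^sup>2 \<partial>M) \<le> 2 * (\<integral>x. (f x - g x)\<^sup>2 \<partial>M) + 2 * (\<integral>x. (g x - h x)\<^sup>2 \<partial>M)"
proof -
  have int: "integrable M (\<lambda>x. (f x - h x)\<^sup>2)" "integrable M (\<lambda>x. (f x - g x)\<^sup>2)"
      "integrable M (\<lambda>x. (g x - h x)\<^sup>2)"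
    using assms sq_integrable_diff unfolding sq_integrable_def by blast+
  \<comment> \<open>The right side minus the left side is exactly the square of a - 2b + c.\<close>
  have "(a - c)\<^sup>2 \<le> 2 * (a - b)\<^sup>2 + 2 * (b - c)\<^sup>2" for a b c :: real
    using zero_le_power2[of "a - 2 * b + c"] by (simp add: power2_eq_square algebra_simps)
  then have "(\<integral>x. (f x - h x)\<^sup>2 \<partial>M) \<le> (\<integral>x. 2 * (f x - g x)\<^sup>2 + 2 * (g x - h x)\<^sup>2 \<partial>M)"
    using int by (intro integral_mono) auto
  then show ?thesis using int by simp
qed

text \<open>Only rational scalars are demanded, so that a countable family qualifies; real scalars
  reappear in the L2 closure, which is what \<open>approx\<close> describes.\<close>

locale rational_span = finite_measure M for M :: "'a measure" +
  fixes \<phi> :: "'k \<Rightarrow> 'a \<Rightarrow> real"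
  assumes sq_span: "\<And>k. sq_integrable M (\<phi> k)"
    and span_add: "\<And>j k. \<exists>l. \<forall>x\<in>space M. \<phi> l x = \<phi> j x + \<phi> k x"
    and span_scale: "\<And>q k. \<exists>l. \<forall>x\<in>space M. \<phi> l x = of_rat q * \<phi> k x"
begin

definition approx :: "('a \<Rightarrow> real) \<Rightarrow> bool" where
  "approx U \<longleftrightarrow> sq_integrable M U \<and> (\<forall>e>0. \<exists>k. (\<integral>x. (U x - \<phi> k x)\<^sup>2 \<partial>M) < e)"

lemma approx_sq: "approx U \<Longrightarrow> sq_integrable M U"
  by (simp add: approx_def)

lemma approx_cong:
  assumes "approx U" "\<And>x. x \<in> space M \<Longrightarrow> U x = V x"
  shows "approx V"
proof -
  have "V \<in> borel_measurable M \<longleftrightarrow> U \<in> borel_measurable M"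
    using assms(2) by (intro measurable_cong) simp
  moreover have "integrable M (\<lambda>x. (V x)\<^sup>2) \<longleftrightarrow> integrable M (\<lambda>x. (U x)\<^sup>2)"
    using assms(2) by (intro Bochner_Integration.integrable_cong) auto
  moreover have "(\<integral>x. (V x - \<phi> k x)\<^sup>2 \<partial>M) = (\<integral>x. (U x - \<phi> k x)\<^sup>2 \<partial>M)" for k
    using assms(2) by (intro Bochner_Integration.integral_cong) auto
  ultimately show ?thesis using assms(1) unfolding approx_def sq_integrable_def by metis
qed

lemma approx_span: "approx (\<phi> k)"
  using sq_span unfolding approx_def by (auto intro!: exI[of _ k])

lemma approx_limit:
  assumes U: "sq_integrable M U"
    and ex: "\<And>e. 0 < e \<Longrightarrow> \<exists>V. approx V \<and> (\<integral>x. (U x - V x)\<^sup>2 \<partial>M) < e"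
  shows "approx U"
  unfolding approx_def
proof (intro conjI U allI impI)
  fix e :: real assume "0 < e"
  then have e: "0 < e / 4" by simp
  obtain V where V: "approx V" "(\<integral>x. (U x - V x)\<^sup>2 \<partial>M) < e / 4" using ex[OF e] by auto
  obtain k where k: "(\<integral>x. (V x - \<phi> k x)\<^sup>2 \<partial>M) < e / 4" using V(1) e unfolding approx_def by blast
  show "\<exists>k. (\<integral>x. (U x - \<phi> k x)\<^sup>2 \<partial>M) < e"
    using integral_sq_dist_le[OF U approx_sq[OF V(1)] sq_span[of k]] V(2) k
    by (intro exI[of _ k]) linarith
qed

lemma approx_add:
  assumes "approx U" "approx V"
  shows "approx (\<lambda>x. U x + V x)"
  unfolding approx_def
proof (intro conjI allI impI)
  note sq = assms[THEN approx_sq]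
  show "sq_integrable M (\<lambda>x. U x + V x)" using sq by (rule sq_integrable_add)
  fix e :: real assume "0 < e"
  then have e: "0 < e / 4" by simp
  obtain j where j: "(\<integral>x. (U x - \<phi> j x)\<^sup>2 \<partial>M) < e / 4" using assms(1) e unfolding approx_def by blast
  obtain k where k: "(\<integral>x. (V x - \<phi> k x)\<^sup>2 \<partial>M) < e / 4" using assms(2) e unfolding approx_def by blast
  obtain l where l: "\<And>x. x \<in> space M \<Longrightarrow> \<phi> l x = \<phi> j x + \<phi> k x" using span_add by metis
  have "(\<integral>x. (U x + V x - \<phi> l x)\<^sup>2 \<partial>M) = (\<integral>x. ((U x + V x) - (\<phi> j x + \<phi> k x))\<^sup>2 \<partial>M)"
    by (intro Bochner_Integration.integral_cong) (auto simp: l)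
  also have "\<dots> \<le> 2 * (\<integral>x. ((U x + V x) - (\<phi> j x + V x))\<^sup>2 \<partial>M)
      + 2 * (\<integral>x. ((\<phi> j x + V x) - (\<phi> j x + \<phi> k x))\<^sup>2 \<partial>M)"
    by (intro integral_sq_dist_le sq_integrable_add sq sq_span)
  also have "\<dots> = 2 * (\<integral>x. (U x - \<phi> j x)\<^sup>2 \<partial>M) + 2 * (\<integral>x. (V x - \<phi> k x)\<^sup>2 \<partial>M)"
    by simp
  finally show "\<exists>l. (\<integral>x. (U x + V x - \<phi> l x)\<^sup>2 \<partial>M) < e"
    using j k by (intro exI[of _ l]) linarith
qed

text \<open>Rational multiples are approximated by multiples of the approximants. A real
  \<open>c\<close> is replaced by a rational \<open>q\<close> at the cost (c - q)^2 times the
  integral of \<open>U\<close> squared, and \<open>approx_limit\<close> absorbs this error.\<close>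

lemma approx_scale:
  assumes U: "approx U"
  shows "approx (\<lambda>x. c * U x)"
proof (rule approx_limit)
  note sq = approx_sq[OF U]
  show "sq_integrable M (\<lambda>x. c * U x)" by (intro sq_integrable_cmult sq)
  have rat: "approx (\<lambda>x. of_rat q * U x)" for q
    unfolding approx_def
  proof (intro conjI allI impI)
    show "sq_integrable M (\<lambda>x. of_rat q * U x)" by (intro sq_integrable_cmult sq)
    fix e :: real assume "0 < e"
    \<comment> \<open>The summand 1 excludes division by zero when \<open>q\<close> is 0.\<close>
    then have "0 < e / ((of_rat q)\<^sup>2 + 1)" by (simp add: add_nonneg_pos)
    then obtain k where k: "(\<integral>x. (U x - \<phi> k x)\<^sup>2 \<partial>M) < e / ((of_rat q)\<^sup>2 + 1)"
      using U unfolding approx_def by blast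
    obtain l where l: "\<And>x. x \<in> space M \<Longrightarrow> \<phi> l x = of_rat q * \<phi> k x" using span_scale by metis
    have "(\<integral>x. (of_rat q * U x - \<phi> l x)\<^sup>2 \<partial>M) = (\<integral>x. (of_rat q)\<^sup>2 * (U x - \<phi> k x)\<^sup>2 \<partial>M)"
      by (intro Bochner_Integration.integral_cong)
        (auto simp: l power_mult_distrib[symmetric] right_diff_distrib)
    also have "\<dots> \<le> ((of_rat q)\<^sup>2 + 1) * (\<integral>x. (U x - \<phi> k x)\<^sup>2 \<partial>M)"
      by (simp add: distrib_right)
    also have "\<dots> < e"
      using k by (subst mult.commute, subst pos_less_divide_eq[symmetric]) (auto simp: add_nonneg_pos)
    finally show "\<exists>l. (\<integral>x. (of_rat q * U x - \<phi> l x)\<^sup>2 \<partial>M) < e" by blast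
  qed
  fix e :: real assume e: "0 < e"
  define I where "I = (\<integral>x. (U x)\<^sup>2 \<partial>M)"
  have I: "0 \<le> I" by (simp add: I_def)
  \<comment> \<open>With d at most 1, a distance below d has a square below d; the denominator I + 1
    stays positive even if I is 0.\<close>
  define d where "d = min 1 (e / (I + 1))"
  have d: "0 < d" "d \<le> 1" "d * I < e"
  proof -
    show "0 < d" "d \<le> 1" using e I by (auto simp: d_def)
    have "d * (I + 1) \<le> e / (I + 1) * (I + 1)" using I by (intro mult_right_mono) (auto simp: d_def)
    moreover have "e / (I + 1) * (I + 1) = e" using I by simp
    ultimately show "d * I < e" using \<open>0 < d\<close> by (simp add: distrib_left)
  qed
  obtain q where q: "c < of_rat q" "of_rat q < c + d" using of_rat_dense[of c "c + d"] d(1) by auto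
  have "(\<integral>x. (c * U x - of_rat q * U x)\<^sup>2 \<partial>M) = (c - of_rat q)\<^sup>2 * I"
    by (simp add: I_def left_diff_distrib[symmetric] power_mult_distrib)
  also have "\<dots> \<le> d * I"
  proof (intro mult_right_mono I)
    have "(c - of_rat q)\<^sup>2 = \<bar>c - of_rat q\<bar> * \<bar>c - of_rat q\<bar>" by (simp add: power2_eq_square)
    also have "\<dots> \<le> d * 1" using q d(2) by (intro mult_mono) auto
    finally show "(c - of_rat q)\<^sup>2 \<le> d" by simp
  qed
  finally show "\<exists>V. approx V \<and> (\<integral>x. (c * U x - V x)\<^sup>2 \<partial>M) < e"
    using rat d(3) by (intro exI[of _ "\<lambda>x. of_rat q * U x"]) auto
qed

lemma approx_zero: "approx (\<lambda>_. 0)"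
  using approx_scale[OF approx_span[of undefined], of 0] by simp

lemma approx_sum:
  "finite I \<Longrightarrow> (\<And>i. i \<in> I \<Longrightarrow> approx (U i)) \<Longrightarrow> approx (\<lambda>x. \<Sum>i\<in>I. U i x)"
  by (induction I rule: finite_induct) (auto intro: approx_zero approx_add)

text \<open>The limit inherits the bound \<open>w\<close>, so the squared distances are dominated by
  4 w^2 and their integrals tend to 0.\<close>

lemma approx_dominated:
  assumes U: "U \<in> borel_measurable M" and V: "\<And>n. approx (V n)"
    and lim: "\<And>x. x \<in> space M \<Longrightarrow> (\<lambda>n. V n x) \<longlonglongrightarrow> U x"
    and w: "sq_integrable M w" "\<And>n x. x \<in> space M \<Longrightarrow> \<bar>V n x\<bar> \<le> w x"
  shows "approx U"
proof (rule approx_limit)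
  have Uw: "\<bar>U x\<bar> \<le> w x" if "x \<in> space M" for x
    using LIMSEQ_le_const2[OF tendsto_rabs[OF lim[OF that]]] w(2)[OF that] by blast
  have [measurable]: "U \<in> borel_measurable M" "\<And>n. V n \<in> borel_measurable M"
    using U V approx_sq sq_integrable_measurable by blast+
  have "integrable M (\<lambda>x. (w x)\<^sup>2)" using w(1) by (simp add: sq_integrable_def)
  moreover have "norm ((U x)\<^sup>2) \<le> norm ((w x)\<^sup>2)" if "x \<in> space M" for x
    using Uw[OF that] by (simp add: abs_le_square_iff[symmetric])
  ultimately show "sq_integrable M U"
    unfolding sq_integrable_def
    by (auto intro: Bochner_Integration.integrable_bound[of M "\<lambda>x. (w x)\<^sup>2"])
  have "(\<lambda>n. \<integral>x. (U x - V n x)\<^sup>2 \<partial>M) \<longlonglongrightarrow> (\<integral>x. 0 \<partial>M)"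
  proof (rule integral_dominated_convergence[where w="\<lambda>x. 4 * (w x)\<^sup>2"])
    show "integrable M (\<lambda>x. 4 * (w x)\<^sup>2)" using w(1) by (simp add: sq_integrable_def)
    show "AE x in M. (\<lambda>n. (U x - V n x)\<^sup>2) \<longlonglongrightarrow> 0"
    proof (rule AE_I2)
      fix x assume "x \<in> space M"
      then have "(\<lambda>n. (U x - V n x)\<^sup>2) \<longlonglongrightarrow> (U x - U x)\<^sup>2" by (intro tendsto_intros lim)
      then show "(\<lambda>n. (U x - V n x)\<^sup>2) \<longlonglongrightarrow> 0" by simp
    qed
    show "AE x in M. norm ((U x - V n x)\<^sup>2) \<le> 4 * (w x)\<^sup>2" for n
    proof (rule AE_I2)
      fix x assume x: "x \<in> space M"
      have "\<bar>U x - V n x\<bar> \<le> \<bar>2 * w x\<bar>" using Uw[OF x] w(2)[OF x, of n] by linarith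
      then show "norm ((U x - V n x)\<^sup>2) \<le> 4 * (w x)\<^sup>2"
        by (simp add: abs_le_square_iff power_mult_distrib)
    qed
  qed auto
  then have "(\<lambda>n. \<integral>x. (U x - V n x)\<^sup>2 \<partial>M) \<longlonglongrightarrow> 0" by simp
  then have "eventually (\<lambda>n. (\<integral>x. (U x - V n x)\<^sup>2 \<partial>M) < e) sequentially" if "0 < e" for e
    using that by (rule order_tendstoD(2))
  then show "\<exists>W. approx W \<and> (\<integral>x. (U x - W x)\<^sup>2 \<partial>M) < e" if "0 < e" for e
    using that V by (fastforce simp: eventually_sequentially)
qed

text \<open>Dynkin's argument: the sets with approximable indicator are closed under complements and
  countable disjoint unions. Complements subtract from the indicator of the whole space, which
  \<open>G\<close> need not contain and which is therefore assumed separately.\<close>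

lemma approx_indicator:
  assumes G: "Int_stable G" "G \<subseteq> Pow (space M)" "sigma_sets (space M) G \<subseteq> sets M"
    and basic: "\<And>B. B \<in> G \<Longrightarrow> approx (indicator B)" "approx (indicator (space M))"
    and B: "B \<in> sigma_sets (space M) G"
  shows "approx (indicator B)"
  using G(1,2) B
proof (induction rule: sigma_sets_induct_disjoint)
  case empty
  show ?case by (rule approx_cong[OF approx_zero]) simp
next
  case (compl B)
  show ?case
    by (rule approx_cong[OF approx_add[OF basic(2) approx_scale[OF compl(2), of "-1"]]])
      (auto split: split_indicator)
next
  case (union F)
  then have [measurable]: "F n \<in> sets M" for n using G(3) by auto
  show ?case
  proof (rule approx_dominated)
    show "approx (\<lambda>x. \<Sum>i<n. indicator (F i) x)" for n
      using union by (intro approx_sum) auto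
    have eq: "(\<Sum>i<n. indicator (F i) x) = (indicator (\<Union>i<n. F i) x :: real)" for n x
      using union(1) by (subst indicator_UN_disjoint) (auto simp: disjoint_family_on_def)
    show "(\<lambda>n. \<Sum>i<n. indicator (F i) x) \<longlonglongrightarrow> (indicator (\<Union>i. F i) x :: real)" for x
      unfolding eq by (rule LIMSEQ_indicator_UN)
    show "\<bar>\<Sum>i<n. indicator (F i) x\<bar> \<le> (1 :: real)" for n x
      unfolding eq by (auto split: split_indicator)
    show "sq_integrable M (\<lambda>_. 1)" by (rule sq_integrable_bounded[of _ 1]) auto
  qed measurable
qed (rule basic(1))

text \<open>Passage from indicators to simple functions to dominated limits, with 2 |U| as the
  bound. \<open>N\<close> governs measurability and \<open>M\<close> the integrals; in the
  application \<open>N\<close> is generated by a random variable on \<open>M\<close>.\<close>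

theorem approx_measurable:
  assumes G: "Int_stable G" "G \<subseteq> Pow (space M)"
    and basic: "\<And>B. B \<in> G \<Longrightarrow> approx (indicator B)" "approx (indicator (space M))"
    and N: "space N = space M" "sets N = sigma_sets (space M) G" "sets N \<subseteq> sets M"
    and U: "U \<in> borel_measurable N" "sq_integrable M U"
  shows "approx U"
proof -
  have ind: "approx (indicator B)" if "B \<in> sets N" for B
    using approx_indicator[OF G _ basic] that N by auto
  have simple: "approx s" if s: "simple_function N s" for s
  proof (rule approx_cong)
    show "approx (\<lambda>x. \<Sum>y\<in>s ` space N. y * indicator (s -` {y} \<inter> space N) x)"
      using s by (intro approx_sum approx_scale ind) (auto simp: simple_function_def)
    show "(\<Sum>y\<in>s ` space N. y * indicator (s -` {y} \<inter> space N) x) = s x" if "x \<in> space M" for x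
    proof -
      have "(\<Sum>y\<in>s ` space N. y * indicator (s -` {y} \<inter> space N) x) =
          (\<Sum>y\<in>s ` space N. if s x = y then y else 0)"
        using that N by (intro sum.cong) (auto split: split_indicator)
      then show ?thesis using s that N by (simp add: simple_function_def)
    qed
  qed
  obtain s where s: "\<And>i. simple_function N (s i)" "\<And>x. x \<in> space N \<Longrightarrow> (\<lambda>i. s i x) \<longlonglongrightarrow> U x"
      "\<And>i x. x \<in> space N \<Longrightarrow> \<bar>s i x\<bar> \<le> 2 * \<bar>U x\<bar>"
    using borel_measurable_implies_sequence_metric[OF U(1), of 0]
    unfolding dist_real_def diff_0_right by metis
  show ?thesis
  proof (rule approx_dominated[where V=s])
    show "sq_integrable M (\<lambda>x. 2 * \<bar>U x\<bar>)"
      using U(2) by (auto simp: sq_integrable_def power_mult_distrib)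
  qed (use s simple N U in \<open>auto simp: sq_integrable_def\<close>)
qed

end

section \<open>Countably generated sigma-algebras and rational step functions\<close>

definition countably_generated :: "'a measure \<Rightarrow> bool" where
  "countably_generated E \<longleftrightarrow>
     (\<exists>G. countable G \<and> G \<subseteq> Pow (space E) \<and> sets E = sigma_sets (space E) G)"

text \<open>Rectangles built from generators generate the product once each factor is covered by its
  generators; adding the whole space to both families ensures this.\<close>

lemma countably_generated_pair:
  assumes "countably_generated A" "countably_generated B"
  shows "countably_generated (A \<Otimes>\<^sub>M B)"
proof -
  have *: "\<exists>G. countable G \<and> G \<subseteq> Pow (space E) \<and> space E \<in> G \<and> sets E = sigma_sets (space E) G"
    if "countably_generated E" for E :: "'z measure"
  proof -
    obtain G where G: "countable G" "G \<subseteq> Pow (space E)" "sets E = sigma_sets (space E) G"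
      using \<open>countably_generated E\<close> by (auto simp: countably_generated_def)
    have "sigma_sets (space E) (insert (space E) G) = sigma_sets (space E) G"
      by (intro sigma_sets_eqI) (auto intro: sigma_sets_top sigma_sets.Basic)
    with G show ?thesis by (intro exI[of _ "insert (space E) G"]) auto
  qed
  obtain G where G: "countable G" "G \<subseteq> Pow (space A)" "space A \<in> G" "sets A = sigma_sets (space A) G"
    using *[OF assms(1)] by blast
  obtain H where H: "countable H" "H \<subseteq> Pow (space B)" "space B \<in> H" "sets B = sigma_sets (space B) H"
    using *[OF assms(2)] by blast
  let ?R = "{a \<times> b | a b. a \<in> G \<and> b \<in> H}"
  have sub: "?R \<subseteq> Pow (space A \<times> space B)" using G H by blast
  have "sets (A \<Otimes>\<^sub>M B) = sets (sigma (space A \<times> space B) ?R)"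
    by (rule sets_pair_eq[where Ca="{space A}" and Cb="{space B}"]) (use G H in auto)
  then have "sets (A \<Otimes>\<^sub>M B) = sigma_sets (space (A \<Otimes>\<^sub>M B)) ?R"
    using sub by (simp add: space_pair_measure)
  moreover have "?R = (\<lambda>(a, b). a \<times> b) ` (G \<times> H)" by auto
  then have "countable ?R" using G H by simp
  ultimately show ?thesis
    unfolding countably_generated_def using sub by (intro exI[of _ ?R]) (auto simp: space_pair_measure)
qed

lemma countably_generated_borel: "countably_generated (borel :: 'b::second_countable_topology measure)"
proof -
  obtain B :: "'b set set" where "countable B" "topological_basis B" using ex_countable_basis by blast
  then show ?thesis
    unfolding countably_generated_def
    by (intro exI[of _ B]) (simp add: borel_eq_countable_basis[of B])
qed

text \<open>Finite intersections of a countable family are again countably many. The empty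
  intersection contributes the whole space, so the family is nonempty and can be listed as a
  sequence.\<close>

lemma countably_generated_Int_stable:
  assumes "countably_generated E"
  obtains A :: "nat \<Rightarrow> 'a set" where "Int_stable (range A)" "space E \<in> range A"
    "range A \<subseteq> Pow (space E)" "sets E = sigma_sets (space E) (range A)"
proof -
  obtain G where G: "countable G" "G \<subseteq> Pow (space E)" "sets E = sigma_sets (space E) G"
    using assms by (auto simp: countably_generated_def)
  define \<A> where "\<A> = (\<lambda>F. space E \<inter> \<Inter>F) ` {F. finite F \<and> F \<subseteq> G}"
  have top: "space E \<in> \<A>" by (auto simp: \<A>_def intro!: image_eqI[of _ _ "{}"])
  have "countable \<A>"
    unfolding \<A>_def by (intro countable_image countable_Collect_finite_subset G)
  with top obtain A :: "nat \<Rightarrow> 'a set" where A: "\<A> = range A"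
    using range_from_nat_into[of \<A>] by (metis empty_iff)
  have "Int_stable \<A>"
    unfolding Int_stable_def
  proof safe
    fix a b assume "a \<in> \<A>" "b \<in> \<A>"
    then obtain F F' where "finite F" "F \<subseteq> G" "a = space E \<inter> \<Inter>F"
        "finite F'" "F' \<subseteq> G" "b = space E \<inter> \<Inter>F'" by (auto simp: \<A>_def)
    then show "a \<inter> b \<in> \<A>" unfolding \<A>_def by (intro image_eqI[of _ _ "F \<union> F'"]) auto
  qed
  moreover have "sets E = sigma_sets (space E) \<A>"
    unfolding G(3)
  proof (rule sigma_sets_eqI)
    fix a assume "a \<in> G"
    then have "a \<in> \<A>" using G(2) unfolding \<A>_def by (intro image_eqI[of _ _ "{a}"]) auto
    then show "a \<in> sigma_sets (space E) \<A>" by auto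
  next
    fix b assume "b \<in> \<A>"
    then obtain F where F: "finite F" "F \<subseteq> G" and b: "b = space E \<inter> \<Inter>F" by (auto simp: \<A>_def)
    have "space E \<inter> \<Inter>F \<in> sets E"
      using F
    proof (induction F)
      case (insert a F)
      have "space E \<inter> \<Inter>(insert a F) = a \<inter> (space E \<inter> \<Inter>F)" by auto
      moreover have "a \<in> sets E" using insert.prems G(3) by auto
      ultimately show ?case using insert by auto
    qed auto
    then show "b \<in> sigma_sets (space E) G" using G(3) b by simp
  qed
  moreover have "\<A> \<subseteq> Pow (space E)" by (auto simp: \<A>_def)
  ultimately show ?thesis using top by (intro that[of A]) (simp_all add: A[symmetric])
qed

text \<open>Step functions are coded by lists, a countable type in which concatenation acts as
  addition; the sets may overlap, so no normal form is needed.\<close>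

definition rational_step :: "(nat \<Rightarrow> 'z set) \<Rightarrow> (rat \<times> nat) list \<Rightarrow> 'z \<Rightarrow> real" where
  "rational_step A K z = (\<Sum>(q, i)\<leftarrow>K. of_rat q * indicator (A i) z)"

lemma rational_step_append: "rational_step A (K @ K') z = rational_step A K z + rational_step A K' z"
  by (simp add: rational_step_def)

lemma rational_step_scale:
  "rational_step A (map (\<lambda>(r, i). (q * r, i)) K) z = of_rat q * rational_step A K z"
  by (induction K) (auto simp: rational_step_def distrib_left of_rat_mult)

lemma measurable_rational_step [measurable]:
  assumes "\<And>i. A i \<in> sets E"
  shows "rational_step A K \<in> borel_measurable E"
proof (induction K)
  case Nil
  then show ?case by (simp add: rational_step_def[abs_def])
next
  case (Cons c K)
  obtain q i where "c = (q, i)" by (cases c)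
  moreover have "(\<lambda>z. of_rat q * indicator (A i) z + rational_step A K z) \<in> borel_measurable E"
    using Cons assms by measurable
  ultimately show ?case by (simp add: rational_step_def[abs_def])
qed

lemma rational_step_bounded: "\<exists>c. \<forall>z. \<bar>rational_step A K z\<bar> \<le> c"
proof (induction K)
  case (Cons x K)
  then obtain c where c: "\<And>z. \<bar>rational_step A K z\<bar> \<le> c" by auto
  obtain q i where x: "x = (q, i)" by (cases x)
  have "\<bar>a * indicator (A i) z + r\<bar> \<le> \<bar>a\<bar> + \<bar>r\<bar>" for a r :: real and z
    by (auto split: split_indicator)
  from this[of "of_rat q" _ "rational_step A K _"]
  have "\<bar>rational_step A (x # K) z\<bar> \<le> \<bar>of_rat q\<bar> + \<bar>rational_step A K z\<bar>" for z
    by (simp add: rational_step_def x)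
  then have "\<bar>rational_step A (x # K) z\<bar> \<le> \<bar>of_rat q\<bar> + c" for z
    using c[of z] by (meson add_left_mono order_trans)
  then show ?case by blast
qed (auto simp: rational_step_def)

text \<open>Preimages under \<open>Z\<close> of an intersection-stable generator of \<open>E\<close>
  form one for the sigma-algebra of \<open>Z\<close>. The step functions live on \<open>E\<close>
  and are fixed before \<open>Z\<close>, so one countable family serves every \<open>Z\<close>; this
  uniformity allows a choice that is measurable in time.\<close>

lemma (in finite_measure) rational_step_dense:
  assumes E: "Int_stable (range A)" "space E \<in> range A" "range A \<subseteq> Pow (space E)"
      "sets E = sigma_sets (space E) (range A)"
    and Z [measurable]: "Z \<in> M \<rightarrow>\<^sub>M E"
    and W: "W \<in> borel_measurable (vimage_algebra (space M) Z E)" "sq_integrable M W" and e: "0 < e"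
  shows "\<exists>K. (\<integral>x. (W x - rational_step A K (Z x))\<^sup>2 \<partial>M) < e"
proof -
  have A [measurable]: "A i \<in> sets E" for i using E(4) by auto
  have Zs: "Z \<in> space M \<rightarrow> space E" using measurable_space[OF Z] by auto
  interpret rational_span M "\<lambda>K x. rational_step A K (Z x)"
  proof
    show "sq_integrable M (\<lambda>x. rational_step A K (Z x))" for K
    proof -
      obtain c where "\<And>z. \<bar>rational_step A K z\<bar> \<le> c" using rational_step_bounded by metis
      then show ?thesis by (intro sq_integrable_bounded[of _ c]) auto
    qed
    show "\<exists>l. \<forall>x\<in>space M. rational_step A l (Z x) = rational_step A j (Z x) + rational_step A k (Z x)" for j k
      using rational_step_append by metis
    show "\<exists>l. \<forall>x\<in>space M. rational_step A l (Z x) = of_rat q * rational_step A k (Z x)" for q k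
      using rational_step_scale by metis
  qed
  let ?G = "(\<lambda>B. Z -` B \<inter> space M) ` range A"
  let ?N = "vimage_algebra (space M) Z E"
  have basic: "approx (indicator B)" if B: "B \<in> ?G" for B
  proof -
    obtain i where "B = Z -` A i \<inter> space M" using B by auto
    then show ?thesis
      by (intro approx_cong[OF approx_span[of "[(1, i)]"]]) (auto simp: rational_step_def split: split_indicator)
  qed
  have "approx W"
  proof (rule approx_measurable[where N="?N" and G="?G"])
    show "Int_stable ?G"
      unfolding Int_stable_def
    proof safe
      fix i j
      have "A i \<inter> A j \<in> range A" using E(1) by (auto simp: Int_stable_def)
      then obtain k where "A i \<inter> A j = A k" by (rule rangeE)
      then show "(Z -` A i \<inter> space M) \<inter> (Z -` A j \<inter> space M) \<in> ?G" by (intro image_eqI[of _ _ "A k"]) auto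
    qed
    have "space M \<in> ?G" using E(2) Zs by (intro image_eqI[of _ _ "space E"]) auto
    then show "approx (indicator (space M))" by (rule basic)
    have "sets ?N = {Z -` B \<inter> space M | B. B \<in> sigma_sets (space E) (range A)}"
      using sets_vimage_algebra2[OF Zs] E(4) by simp
    also have "\<dots> = sigma_sets (space M) {Z -` B \<inter> space M | B. B \<in> range A}"
      by (rule sigma_sets_vimage_commute[OF Zs])
    also have "{Z -` B \<inter> space M | B. B \<in> range A} = ?G" by auto
    finally show "sets ?N = sigma_sets (space M) ?G" .
    show "sets ?N \<subseteq> sets M" using sets_vimage_algebra2[OF Zs] by auto
  qed (use basic W in auto)
  then show ?thesis using e by (auto simp: approx_def)
qed

section \<open>Jointly measurable conditional expectations\<close>

lemma subalgebra_vimage: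
  assumes "Z \<in> M \<rightarrow>\<^sub>M E" shows "subalgebra M (vimage_algebra (space M) Z E)"
  using measurable_sets[OF assms] sets_vimage_algebra2[of Z "space M" E] measurable_space[OF assms]
  by (auto simp: subalgebra_def)

text \<open>Conditional Jensen inequality for the square.\<close>

lemma (in finite_measure_subalgebra) sq_integrable_real_cond_exp:
  assumes "sq_integrable M Y"
  shows "sq_integrable M (real_cond_exp M F Y)"
  unfolding sq_integrable_def
proof
  show "integrable M (\<lambda>x. (real_cond_exp M F Y x)\<^sup>2)"
    using assms sq_integrable_integrable[OF assms]
    by (intro integrable_convex_cond_exp[where I=UNIV])
      (auto simp: sq_integrable_def convex_power2 emeasure_eq_measure)
qed simp

text \<open>The sum of the squared distances has finite integral, hence is finite almost everywhere,
  so its terms tend to 0. The geometric rate gives convergence of the whole sequence; a subsequence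
  could depend on t.\<close>

lemma AE_tendsto_of_summable_sq_dist:
  fixes W :: "'a \<Rightarrow> real"
  assumes [measurable]: "W \<in> borel_measurable M" "\<And>n. f n \<in> borel_measurable M"
    and int: "\<And>n. integrable M (\<lambda>x. (W x - f n x)\<^sup>2)"
    and le: "\<And>n. (\<integral>x. (W x - f n x)\<^sup>2 \<partial>M) \<le> (1/2) ^ n"
  shows "AE x in M. (\<lambda>n. f n x) \<longlonglongrightarrow> W x"
proof -
  have "(\<integral>\<^sup>+x. (\<Sum>n. ennreal ((W x - f n x)\<^sup>2)) \<partial>M) = (\<Sum>n. \<integral>\<^sup>+x. ennreal ((W x - f n x)\<^sup>2) \<partial>M)"
    by (rule nn_integral_suminf) measurable
  also have "\<dots> \<le> (\<Sum>n. ennreal ((1/2) ^ n))"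
    using le int by (intro suminf_le) (auto simp: nn_integral_eq_integral intro: ennreal_leI)
  also have "\<dots> = ennreal (\<Sum>n. (1/2) ^ n)"
    by (intro suminf_ennreal2) (auto simp: summable_geometric)
  also have "\<dots> < \<infinity>" by simp
  finally have "AE x in M. (\<Sum>n. ennreal ((W x - f n x)\<^sup>2)) \<noteq> \<infinity>"
    by (intro nn_integral_PInf_AE) auto
  then show ?thesis
  proof eventually_elim
    case (elim x)
    then have "summable (\<lambda>n. (W x - f n x)\<^sup>2)" by (intro summable_suminf_not_top) auto
    then have "(\<lambda>n. (W x - f n x)\<^sup>2) \<longlonglongrightarrow> 0" by (rule summable_LIMSEQ_zero)
    then have "(\<lambda>n. sqrt ((W x - f n x)\<^sup>2)) \<longlonglongrightarrow> sqrt 0" by (rule tendsto_real_sqrt)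
    then have "(\<lambda>n. \<bar>f n x - W x\<bar>) \<longlonglongrightarrow> 0" by (simp add: abs_minus_commute)
    then show ?case by (simp add: LIM_zero_iff tendsto_rabs_zero_iff)
  qed
qed

text \<open>
  For fixed \<open>t\<close>, the square distance of \<open>s(Z\<^sub>t)\<close> from \<open>E[Y | Z\<^sub>t]\<close> is, up to a constant, the
  functional \<open>E[s(Z\<^sub>t)\<^sup>2] - 2 E[Y s(Z\<^sub>t)]\<close>, which by Fubini is measurable in \<open>t\<close>.  Hence so is
  the first index of a countable dense family at which it is nearly minimal.
\<close>

theorem (in prob_space) jointly_measurable_cond_exp:
  assumes E: "countably_generated E"
    and Z [measurable]: "case_prod Z \<in> \<Theta> \<Otimes>\<^sub>M M \<rightarrow>\<^sub>M E"
    and Y: "sq_integrable M Y"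
  shows "\<exists>g\<in>borel_measurable (\<Theta> \<Otimes>\<^sub>M E). \<forall>t\<in>space \<Theta>.
    AE \<omega> in M. g (t, Z t \<omega>) = real_cond_exp M (vimage_algebra (space M) (Z t) E) Y \<omega>"
proof -
  obtain A :: "nat \<Rightarrow> _" where A: "Int_stable (range A)" "space E \<in> range A"
      "range A \<subseteq> Pow (space E)" "sets E = sigma_sets (space E) (range A)"
    using countably_generated_Int_stable[OF E] by metis
  have [measurable]: "A i \<in> sets E" for i using A(4) by auto
  have [measurable]: "Y \<in> borel_measurable M" using Y by measurable
  define s where "s n = rational_step A (from_nat n)" for n
  have [measurable]: "s n \<in> borel_measurable E" for n unfolding s_def by measurable
  define c where "c n t = (\<integral>\<omega>. (s n (Z t \<omega>))\<^sup>2 - 2 * (Y \<omega> * s n (Z t \<omega>)) \<partial>M)" for n t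
  have [measurable]: "c n \<in> borel_measurable \<Theta>" for n
    unfolding c_def[abs_def] by measurable
  define m where "m t = (INF n. c n t)" for t
  have [measurable]: "m \<in> borel_measurable \<Theta>" unfolding m_def[abs_def] by measurable
  \<comment> \<open>The infimum need not be attained, hence the positive tolerance; its size is the
    rate required for almost sure convergence.\<close>
  define k where "k j t = (LEAST n. c n t < m t + (1/2) ^ j)" for j t
  have [measurable]: "k j \<in> \<Theta> \<rightarrow>\<^sub>M count_space UNIV" for j
    unfolding k_def[abs_def] by measurable
  have ks [measurable]: "(\<lambda>(t, z). s (k j t) z) \<in> borel_measurable (\<Theta> \<Otimes>\<^sub>M E)" for j
    unfolding case_prod_beta
    \<comment> \<open>The index takes countably many values, so the composition is measurable piece
      by piece.\<close>
    by (rule measurable_compose_countable[where g="\<lambda>x. k j (fst x)" and f="\<lambda>n x. s n (snd x)"]) measurable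
  \<comment> \<open>Where the sequence diverges, \<open>lim\<close> has an unspecified value; for
    every t such points are met by \<open>Z t\<close> with probability 0 only.\<close>
  define g where "g = (\<lambda>(t, z). lim (\<lambda>j. s (k j t) z))"
  have "g \<in> borel_measurable (\<Theta> \<Otimes>\<^sub>M E)"
    unfolding g_def case_prod_beta using ks[unfolded case_prod_beta] by (rule borel_measurable_lim_metric)
  moreover have "AE \<omega> in M. g (t, Z t \<omega>) = real_cond_exp M (vimage_algebra (space M) (Z t) E) Y \<omega>"
    if t: "t \<in> space \<Theta>" for t
  proof -
    have Zt [measurable]: "Z t \<in> M \<rightarrow>\<^sub>M E" using measurable_Pair2[OF Z t] by simp
    let ?F = "vimage_algebra (space M) (Z t) E"
    have ZF [measurable]: "Z t \<in> ?F \<rightarrow>\<^sub>M E"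
      using measurable_space[OF Zt] by (intro measurable_vimage_algebra1) auto
    interpret sub: finite_measure_subalgebra M ?F
      by unfold_locales (rule subalgebra_vimage[OF Zt])
    define W where "W = real_cond_exp M ?F Y"
    have W: "sq_integrable M W" unfolding W_def by (rule sub.sq_integrable_real_cond_exp[OF Y])
    have WF: "W \<in> borel_measurable ?F" unfolding W_def by simp
    have s_sq: "sq_integrable M (\<lambda>\<omega>. s n (Z t \<omega>))" for n
    proof -
      obtain u where "\<And>z. \<bar>s n z\<bar> \<le> u" using rational_step_bounded unfolding s_def by metis
      then show ?thesis by (intro sq_integrable_bounded[of _ u]) auto
    qed
    \<comment> \<open>In the cross term, \<open>s n (Z t \<omega>)\<close> is measurable for the
      conditioning sigma-algebra, so \<open>Y\<close> may be exchanged for its conditional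
      expectation \<open>W\<close>.\<close>
    have c_eq: "c n t = (\<integral>\<omega>. (W \<omega> - s n (Z t \<omega>))\<^sup>2 \<partial>M) - (\<integral>\<omega>. (W \<omega>)\<^sup>2 \<partial>M)" for n
    proof -
      note int = s_sq[of n, unfolded sq_integrable_def, THEN conjunct2]
        W[unfolded sq_integrable_def, THEN conjunct2]
        sq_integrable_mult[OF s_sq[of n] Y] sq_integrable_mult[OF s_sq[of n] W]
      have "(\<integral>\<omega>. s n (Z t \<omega>) * W \<omega> \<partial>M) = (\<integral>\<omega>. s n (Z t \<omega>) * Y \<omega> \<partial>M)"
        unfolding W_def using int(3) by (intro sub.real_cond_exp_intg) auto
      moreover have "(\<integral>\<omega>. (W \<omega> - s n (Z t \<omega>))\<^sup>2 \<partial>M) =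
          (\<integral>\<omega>. (W \<omega>)\<^sup>2 + (s n (Z t \<omega>))\<^sup>2 - 2 * (s n (Z t \<omega>) * W \<omega>) \<partial>M)"
        by (simp add: power2_diff ac_simps)
      moreover have "\<dots> = (\<integral>\<omega>. (W \<omega>)\<^sup>2 \<partial>M) + (\<integral>\<omega>. (s n (Z t \<omega>))\<^sup>2 \<partial>M) - 2 * (\<integral>\<omega>. s n (Z t \<omega>) * W \<omega> \<partial>M)"
        using int by simp
      moreover have "c n t = (\<integral>\<omega>. (s n (Z t \<omega>))\<^sup>2 \<partial>M) - 2 * (\<integral>\<omega>. s n (Z t \<omega>) * Y \<omega> \<partial>M)"
        unfolding c_def using int by (simp add: mult.commute[of "Y _"])
      ultimately show ?thesis by simp
    qed
    \<comment> \<open>By density the infimum of the squared distances is 0, which leaves only the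
      constant.\<close>
    have m_eq: "m t = - (\<integral>\<omega>. (W \<omega>)\<^sup>2 \<partial>M)"
      unfolding m_def
    proof (rule cInf_eq_non_empty)
      fix e assume "e \<in> range (\<lambda>n. c n t)"
      then show "- (\<integral>\<omega>. (W \<omega>)\<^sup>2 \<partial>M) \<le> e" by (auto simp: c_eq)
    next
      fix y assume y: "\<And>x. x \<in> range (\<lambda>n. c n t) \<Longrightarrow> y \<le> x"
      show "y \<le> - (\<integral>\<omega>. (W \<omega>)\<^sup>2 \<partial>M)"
      proof (rule field_le_epsilon)
        fix e :: real assume "0 < e"
        then obtain K where "(\<integral>\<omega>. (W \<omega> - rational_step A K (Z t \<omega>))\<^sup>2 \<partial>M) < e"
          using rational_step_dense[OF A Zt WF W] by blast
        then have "c (to_nat K) t < e - (\<integral>\<omega>. (W \<omega>)\<^sup>2 \<partial>M)" by (simp add: c_eq s_def)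
        then show "y \<le> - (\<integral>\<omega>. (W \<omega>)\<^sup>2 \<partial>M) + e" using y[of "c (to_nat K) t"] by auto
      qed
    qed auto
    have "c (k j t) t < m t + (1/2) ^ j" for j
    proof -
      obtain K where "(\<integral>\<omega>. (W \<omega> - rational_step A K (Z t \<omega>))\<^sup>2 \<partial>M) < (1/2) ^ j"
        using rational_step_dense[OF A Zt WF W, of "(1/2) ^ j"] by auto
      then have "c (to_nat K) t < m t + (1/2) ^ j" by (simp add: c_eq s_def m_eq)
      then show ?thesis unfolding k_def by (rule LeastI)
    qed
    then have "(\<integral>\<omega>. (W \<omega> - s (k j t) (Z t \<omega>))\<^sup>2 \<partial>M) \<le> (1/2) ^ j" for j
      using c_eq[of "k j t"] m_eq by (smt (verit))
    moreover have "integrable M (\<lambda>\<omega>. (W \<omega> - s (k j t) (Z t \<omega>))\<^sup>2)" for j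
      using sq_integrable_diff[OF W s_sq] by (simp add: sq_integrable_def)
    ultimately have "AE \<omega> in M. (\<lambda>j. s (k j t) (Z t \<omega>)) \<longlonglongrightarrow> W \<omega>"
      using W by (intro AE_tendsto_of_summable_sq_dist) (auto simp: sq_integrable_def)
    then show ?thesis by eventually_elim (simp add: g_def W_def limI)
  qed
  ultimately show ?thesis by blast
qed

section \<open>Filtrations, processes and the Markov property\<close>

lemma sets_sigma_subset:
  assumes "A \<subseteq> sets N" "space N = \<Omega>"
  shows "sets (sigma \<Omega> A) \<subseteq> sets N"
  using assms sets.space_closed[of N] sets.sigma_sets_subset[of A N] by (subst sets_measure_of) auto

text \<open>\<open>F\<close> contains the past of an adapted process, all subsets of null sets by
  completeness, and the intersection over later times by right continuity. At \<open>T\<close> there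
  is no later time, hence the case distinction.\<close>

lemma subalgebra_usual_augmentation:
  assumes F: "usual_conditions T P F" and Z: "adapted T F E Z" and t: "0 \<le> t" "t \<le> T"
  shows "subalgebra (F t) (usual_augmentation T P (natural_filtration P E Z) t)"
proof -
  have sub: "space (F u) = space P" "\<And>v. v \<in> {0..u} \<Longrightarrow> sets (F v) \<subseteq> sets (F u)" if "u \<in> {0..T}" for u
    using F that by (auto simp: usual_conditions_def filtration_on_def subalgebra_def)
  have nat: "sets (natural_filtration P E Z u) \<subseteq> sets (F u)" if u: "u \<in> {0..T}" for u
    unfolding natural_filtration_def
  proof (rule sets_sigma_subset)
    show "{Z s -` B \<inter> space P |s B. s \<in> {0..u} \<and> B \<in> sets E} \<subseteq> sets (F u)"
    proof safe
      fix s B assume s: "s \<in> {0..u}" and B: "B \<in> sets E"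
      have sT: "s \<in> {0..T}" using s u by auto
      then have "Z s \<in> F s \<rightarrow>\<^sub>M E" using Z by (simp add: adapted_def)
      from measurable_sets[OF this B] show "Z s -` B \<inter> space P \<in> sets (F u)"
        using sub(1)[OF sT] sub(2)[OF u s] by auto
    qed
  qed (rule sub(1)[OF u])
  have null: "{B. \<exists>N\<in>null_sets P. B \<subseteq> N} \<subseteq> sets (F u)" if u: "u \<in> {0..T}" for u
  proof -
    have "{B. \<exists>N\<in>null_sets P. B \<subseteq> N} \<subseteq> sets (F 0)" using F by (auto simp: usual_conditions_def)
    also have "\<dots> \<subseteq> sets (F u)" using sub(2)[OF u, of 0] u by auto
    finally show ?thesis .
  qed
  let ?G = "\<lambda>u. sigma_sets (space P)
    (sets (natural_filtration P E Z u) \<union> {B. \<exists>N\<in>null_sets P. B \<subseteq> N})"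
  have G: "?G u \<subseteq> sets (F u)" if "u \<in> {0..T}" for u
    using sets.sigma_sets_subset[OF Un_least[OF nat[OF that] null[OF that]]] sub(1)[OF that] by simp
  have "(\<Inter>u\<in>(if t < T then {t<..T} else {T}). ?G u) \<subseteq> sets (F t)"
  proof (cases "t < T")
    case True
    then have "(\<Inter>u\<in>{t<..T}. ?G u) \<subseteq> (\<Inter>u\<in>{t<..T}. sets (F u))" using G t by (intro INT_anti_mono) auto
    also have "\<dots> = sets (F t)" using F True t by (auto simp: usual_conditions_def)
    finally show ?thesis using True by simp
  next
    case False
    then show ?thesis using G[of T] t by auto
  qed
  then have "sets (usual_augmentation T P (natural_filtration P E Z) t) \<subseteq> sets (F t)"
    unfolding usual_augmentation_def by (rule sets_sigma_subset) (use sub(1)[of t] t in simp)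
  moreover have "space (usual_augmentation T P (natural_filtration P E Z) t) = space (F t)"
    unfolding usual_augmentation_def using sub(1)[of t] t by (simp add: space_measure_of_conv)
  ultimately show ?thesis by (simp add: subalgebra_def)
qed

text \<open>A right continuous process is the limit of its values at the next point of the grid
  \<open>1/(n+1) \<int>\<close>.\<close>

lemma cadlag_measurable_process:
  assumes Z: "cadlag T P Z" and meas: "\<And>t. t \<in> {0..T} \<Longrightarrow> Z t \<in> borel_measurable P" and T: "0 \<le> T"
  shows "measurable_process T P borel Z"
proof -
  \<comment> \<open>The added 1 makes the grid point strictly later than \<open>t\<close>, as
    convergence along \<open>at_right t\<close> requires; clamping sends \<open>T\<close> to itself,
    where no right limit is available.\<close>
  define u where "u n t = max 0 (min T ((real_of_int \<lfloor>t * Suc n\<rfloor> + 1) / Suc n))" for n :: nat and t :: real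
  have "(\<lambda>x. Z (u n (fst x)) (snd x)) \<in> borel_measurable (restrict_space borel {0..T} \<Otimes>\<^sub>M P)" for n
    unfolding u_def
  proof (rule measurable_compose_countable[where g="\<lambda>x. \<lfloor>(fst x :: real) * Suc n\<rfloor>"
        and f="\<lambda>z x. Z (max 0 (min T ((real_of_int z + 1) / Suc n))) (snd x)"])
    show "(\<lambda>x. Z (max 0 (min T ((real_of_int z + 1) / Suc n))) (snd x))
        \<in> borel_measurable (restrict_space borel {0..T} \<Otimes>\<^sub>M P)" for z
      by (rule measurable_compose[OF measurable_snd meas]) (use T in auto)
    have "fst \<in> restrict_space borel {0..T} \<Otimes>\<^sub>M P \<rightarrow>\<^sub>M (borel :: real measure)"
      by (rule measurable_fst'') (rule measurable_restrict_space1, simp)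
    then show "(\<lambda>x. \<lfloor>fst x * Suc n\<rfloor>) \<in> restrict_space borel {0..T} \<Otimes>\<^sub>M P \<rightarrow>\<^sub>M count_space UNIV"
      by measurable
  qed
  moreover have "(\<lambda>n. Z (u n t) \<omega>) \<longlonglongrightarrow> Z t \<omega>" if t: "t \<in> {0..T}" and \<omega>: "\<omega> \<in> space P" for t \<omega>
  proof (cases "t = T")
    case True
    have "T \<le> (real_of_int \<lfloor>T * Suc n\<rfloor> + 1) / Suc n" for n
      by (subst pos_le_divide_eq) (auto simp: real_of_int_floor_add_one_ge)
    then show ?thesis using True T by (simp add: u_def)
  next
    case False
    then have tT: "t < T" using t by auto
    have gt: "t < (real_of_int \<lfloor>t * Suc n\<rfloor> + 1) / Suc n" for n
      by (subst pos_less_divide_eq) (auto simp: real_of_int_floor_add_one_gt)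
    have le: "(real_of_int \<lfloor>t * Suc n\<rfloor> + 1) / Suc n \<le> t + 1 / Suc n" for n
    proof -
      have "(real_of_int \<lfloor>t * Suc n\<rfloor> + 1) / Suc n \<le> (t * Suc n + 1) / Suc n"
        by (intro divide_right_mono add_right_mono of_int_floor_le) auto
      then show ?thesis by (simp add: add_divide_distrib)
    qed
    have u: "t < u n t" "u n t \<le> t + 1 / Suc n" for n
      using gt[of n] le[of n] tT t by (auto simp: u_def)
    have "(\<lambda>n. t + 1 / Suc n) \<longlonglongrightarrow> t + 0"
      by (rule tendsto_add[OF tendsto_const LIMSEQ_Suc[OF lim_1_over_n]])
    then have lim: "(\<lambda>n. t + 1 / Suc n) \<longlonglongrightarrow> t" by simp
    have "(\<lambda>n. u n t) \<longlonglongrightarrow> t"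
      by (rule tendsto_sandwich[OF always_eventually always_eventually tendsto_const lim])
        (use u less_imp_le in blast)+
    then have "filterlim (\<lambda>n. u n t) (at_right t) sequentially"
      using u(1) by (intro filterlim_at_withinI) auto
    moreover have "((\<lambda>s. Z s \<omega>) \<longlongrightarrow> Z t \<omega>) (at_right t)" using Z \<omega> t tT by (simp add: cadlag_def)
    ultimately show ?thesis by (rule filterlim_compose[rotated])
  qed
  ultimately show ?thesis
    unfolding measurable_process_def case_prod_beta
    by (rule borel_measurable_LIMSEQ_metric) (auto simp: space_pair_measure space_restrict_space)
qed

text \<open>The integrand varies with x, but pushing \<open>K x\<close> forward along
  \<open>Pair x\<close> turns the integral into that of the fixed function \<open>f\<close> against
  a measurable kernel on the product.\<close>

lemma borel_measurable_kernel_integral: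
  fixes f :: "'b \<times> 'c \<Rightarrow> real"
  assumes f [measurable]: "f \<in> borel_measurable (M \<Otimes>\<^sub>M N)" and K [measurable]: "K \<in> M \<rightarrow>\<^sub>M subprob_algebra N"
  shows "(\<lambda>x. \<integral>y. f (x, y) \<partial>K x) \<in> borel_measurable M"
proof -
  have "(\<lambda>x. distr (K x) (M \<Otimes>\<^sub>M N) (Pair x)) \<in> M \<rightarrow>\<^sub>M subprob_algebra (M \<Otimes>\<^sub>M N)"
    by (rule measurable_distr2[OF _ K]) (simp add: case_prod_beta)
  then have "(\<lambda>x. integral\<^sup>L (distr (K x) (M \<Otimes>\<^sub>M N) (Pair x)) f) \<in> borel_measurable M"
    by (rule measurable_compose[OF _ integral_measurable_subprob_algebra[OF f]])
  moreover have "integral\<^sup>L (distr (K x) (M \<Otimes>\<^sub>M N) (Pair x)) f = (\<integral>y. f (x, y) \<partial>K x)"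
    if x: "x \<in> space M" for x
  proof (rule integral_distr[OF _ f])
    have "sets (K x) = sets N" using measurable_space[OF K x] by (simp add: space_subprob_algebra)
    then show "Pair x \<in> K x \<rightarrow>\<^sub>M M \<Otimes>\<^sub>M N"
      using measurable_Pair1'[OF x, of N] by (simp cong: measurable_cong_sets)
  qed
  ultimately show ?thesis by (simp cong: measurable_cong)
qed

text \<open>Monotonicity for \<open>Y\<close> and for its negative bounds the absolute value by the
  conditional expectation of |Y|.\<close>

lemma (in finite_measure_subalgebra) integral_abs_real_cond_exp_le:
  assumes Y: "integrable M Y"
  shows "(\<integral>x. \<bar>real_cond_exp M F Y x\<bar> \<partial>M) \<le> (\<integral>x. \<bar>Y x\<bar> \<partial>M)"
proof -
  have "AE x in M. real_cond_exp M F Y x \<le> real_cond_exp M F (\<lambda>x. \<bar>Y x\<bar>) x"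
    using Y by (intro real_cond_exp_mono) auto
  moreover have "AE x in M. real_cond_exp M F (\<lambda>x. (-1) * Y x) x \<le> real_cond_exp M F (\<lambda>x. \<bar>Y x\<bar>) x"
    using Y by (intro real_cond_exp_mono) auto
  moreover have "AE x in M. real_cond_exp M F (\<lambda>x. (-1) * Y x) x = (-1) * real_cond_exp M F Y x"
    using Y by (rule real_cond_exp_cmult)
  ultimately have "AE x in M. \<bar>real_cond_exp M F Y x\<bar> \<le> real_cond_exp M F (\<lambda>x. \<bar>Y x\<bar>) x"
    by eventually_elim auto
  then have "(\<integral>x. \<bar>real_cond_exp M F Y x\<bar> \<partial>M) \<le> (\<integral>x. real_cond_exp M F (\<lambda>x. \<bar>Y x\<bar>) x \<partial>M)"
    using Y real_cond_exp_int(1) by (intro integral_mono_AE) auto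
  also have "\<dots> = (\<integral>x. \<bar>Y x\<bar> \<partial>M)" using Y by (intro real_cond_exp_int(2)) auto
  finally show ?thesis .
qed

text \<open>Carries the Markov property from bounded to integrable functions. It suffices to compare
  integrals over sets of \<open>F\<close>; the truncations converge in L1 and conditioning is an L1
  contraction, so the discrepancy is at most twice the truncation error.\<close>

lemma (in finite_measure) real_cond_exp_eq_if_truncations:
  assumes F: "subalgebra M F" and G: "subalgebra F G" and Y: "integrable M Y"
    and trunc: "\<And>n :: nat. AE x in M. real_cond_exp M F (\<lambda>x. max (- real n) (min (real n) (Y x))) x
      = real_cond_exp M G (\<lambda>x. max (- real n) (min (real n) (Y x))) x"
  shows "AE x in M. real_cond_exp M F Y x = real_cond_exp M G Y x"
proof -
  have MG: "subalgebra M G" using F G by (auto simp: subalgebra_def)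
  interpret F: finite_measure_subalgebra M F by unfold_locales (rule F)
  interpret G: finite_measure_subalgebra M G by unfold_locales (rule MG)
  define Y' where "Y' n x = max (- real n) (min (real n) (Y x))" for n x
  have [measurable]: "Y \<in> borel_measurable M" using Y by simp
  have [measurable]: "Y' n \<in> borel_measurable M" for n unfolding Y'_def[abs_def] by measurable
  have Y' [simp]: "integrable M (Y' n)" for n
    using Y by (rule Bochner_Integration.integrable_bound) (auto simp: Y'_def)
  have "(\<lambda>n. \<integral>x. \<bar>Y x - Y' n x\<bar> \<partial>M) \<longlonglongrightarrow> (\<integral>x. 0 \<partial>M)"
  proof (rule integral_dominated_convergence[where w="\<lambda>x. \<bar>Y x\<bar>"])
    show "AE x in M. (\<lambda>n. \<bar>Y x - Y' n x\<bar>) \<longlonglongrightarrow> 0"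
    proof (rule AE_I2)
      fix x
      have "\<bar>Y x - Y' n x\<bar> = 0" if "n \<ge> nat \<lceil>\<bar>Y x\<bar>\<rceil>" for n
      proof -
        have "\<bar>Y x\<bar> \<le> real n" using that by (simp add: nat_ceiling_le_eq)
        then show ?thesis by (simp add: Y'_def abs_le_iff max_def min_def)
      qed
      then have "eventually (\<lambda>n. \<bar>Y x - Y' n x\<bar> = 0) sequentially"
        by (rule eventually_sequentiallyI)
      then show "(\<lambda>n. \<bar>Y x - Y' n x\<bar>) \<longlonglongrightarrow> 0"
        by (rule tendsto_eventually)
    qed
  qed (use Y in \<open>auto simp: Y'_def\<close>)
  then have lim: "(\<lambda>n. 2 * (\<integral>x. \<bar>Y x - Y' n x\<bar> \<partial>M)) \<longlonglongrightarrow> 0"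
    by (auto intro: tendsto_mult_right_zero)
  show ?thesis
  proof (rule F.real_cond_exp_charact)
    fix A assume A: "A \<in> sets F"
    then have [measurable]: "A \<in> sets M" using F by (auto simp: subalgebra_def)
    have ind: "integrable M (\<lambda>x. indicator A x * U x)" if "integrable M U" for U :: "_ \<Rightarrow> real"
      using that by (rule Bochner_Integration.integrable_bound) (use that in \<open>auto split: split_indicator\<close>)
    have small: "\<bar>\<integral>x. indicator A x * U x \<partial>M\<bar> \<le> (\<integral>x. \<bar>U x\<bar> \<partial>M)" if "integrable M U" for U :: "_ \<Rightarrow> real"
    proof -
      have "\<bar>\<integral>x. indicator A x * U x \<partial>M\<bar> \<le> (\<integral>x. \<bar>indicator A x * U x\<bar> \<partial>M)" by (rule integral_abs_bound)
      also have "\<dots> \<le> (\<integral>x. \<bar>U x\<bar> \<partial>M)"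
        using that ind[OF that] by (intro integral_mono) (auto split: split_indicator)
      finally show ?thesis .
    qed
    let ?D = "(\<integral>x. indicator A x * Y x \<partial>M) - (\<integral>x. indicator A x * real_cond_exp M G Y x \<partial>M)"
    have "\<bar>?D\<bar> \<le> 2 * (\<integral>x. \<bar>Y x - Y' n x\<bar> \<partial>M)" for n
    proof -
      have intG: "integrable M (real_cond_exp M G Y)" "integrable M (real_cond_exp M G (Y' n))"
        using Y by (auto intro: G.real_cond_exp_int)
      have "(\<integral>x. indicator A x * Y' n x \<partial>M) = (\<integral>x. indicator A x * real_cond_exp M F (Y' n) x \<partial>M)"
        using A ind[OF Y'] by (intro F.real_cond_exp_intg(2)[symmetric]) auto
      also have "\<dots> = (\<integral>x. indicator A x * real_cond_exp M G (Y' n) x \<partial>M)"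
        using trunc[of n] unfolding Y'_def by (intro integral_cong_AE) auto
      finally have eq: "(\<integral>x. indicator A x * Y' n x \<partial>M) = \<dots>" .
      have "AE x in M. real_cond_exp M G (\<lambda>x. Y x - Y' n x) x = real_cond_exp M G Y x - real_cond_exp M G (Y' n) x"
        using Y by (intro G.real_cond_exp_diff) auto
      then have "(\<integral>x. indicator A x * real_cond_exp M G (\<lambda>x. Y x - Y' n x) x \<partial>M) =
          (\<integral>x. indicator A x * real_cond_exp M G Y x - indicator A x * real_cond_exp M G (Y' n) x \<partial>M)"
        by (intro integral_cong_AE) (auto simp: right_diff_distrib)
      then have "?D = (\<integral>x. indicator A x * (Y x - Y' n x) \<partial>M)
          - (\<integral>x. indicator A x * real_cond_exp M G (\<lambda>x. Y x - Y' n x) x \<partial>M)"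
        using ind[OF Y] ind[OF Y'] ind[OF intG(1)] ind[OF intG(2)] eq by (simp add: right_diff_distrib)
      moreover have "\<bar>\<integral>x. indicator A x * (Y x - Y' n x) \<partial>M\<bar> \<le> (\<integral>x. \<bar>Y x - Y' n x\<bar> \<partial>M)"
        using Y by (intro small) auto
      moreover have "\<bar>\<integral>x. indicator A x * real_cond_exp M G (\<lambda>x. Y x - Y' n x) x \<partial>M\<bar>
          \<le> (\<integral>x. \<bar>Y x - Y' n x\<bar> \<partial>M)"
        using Y by (intro order_trans[OF small G.integral_abs_real_cond_exp_le])
          (auto intro: G.real_cond_exp_int)
      ultimately show ?thesis by linarith
    qed
    then have "\<bar>?D\<bar> \<le> 0" by (intro LIMSEQ_le_const[OF lim]) blast
    then show "(\<integral>x\<in>A. Y x \<partial>M) = (\<integral>x\<in>A. real_cond_exp M G Y x \<partial>M)"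
      by (simp add: set_lebesgue_integral_def)
  next
    show "real_cond_exp M G Y \<in> borel_measurable F"
      by (rule measurable_from_subalg[OF G]) simp
  qed (use Y in \<open>auto intro: G.real_cond_exp_int\<close>)
qed

section \<open>The representation\<close>

text \<open>\<open>g\<close> is not unique, so existence and representation are separate conjuncts,
  the latter for every admissible \<open>g\<close>. The exceptional null sets may depend on
  t.\<close>

theorem proposition4p2:
  fixes T k :: real
    and P Pstar :: "'a measure"
    and F FS :: "real \<Rightarrow> 'a measure"
    and S M Mc Md A Ac Ad \<alpha> I L X V :: "real \<Rightarrow> 'a \<Rightarrow> real"
    and \<rho> :: "real \<Rightarrow> real"
    and \<pi> :: "real \<Rightarrow> 'a \<Rightarrow> real measure"
    and H :: "real \<times> real \<times> real \<Rightarrow> real"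
    and \<xi> o\<xi> :: "'a \<Rightarrow> real"
  assumes T_pos: "0 < T"
    and prob: "prob_space P"
    and usual: "usual_conditions T P F"
    and F_T: "sets (F T) = sets P"
    (* the price process and the structure condition; A is \<langle>M\<rangle> *)
    and S_semimartingale: "semimartingale T P F S"
    and S_sq: "square_integrable_process T P S"
    and M_martingale: "square_integrable_martingale T P F M"
    and M_0: "AE \<omega> in P. M 0 \<omega> = 0"
    and M_qv: "predictable_qv T P F M A"
    and \<alpha>_predictable: "predictable T P F \<alpha>"
    and \<alpha>_sq: "(\<integral>\<^sup>+ \<omega>. (\<integral>\<^sup>+ t\<in>{0<..T}. ennreal ((\<alpha> t \<omega>)\<^sup>2) \<partial>path_measure T A \<omega>) \<partial>P) < \<infinity>"
    and structure_condition: "AE \<omega> in P. \<forall>t\<in>{0..T}.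
          S t \<omega> = S 0 \<omega> + M t \<omega> + (LINT u:{0<..t}|path_measure T A \<omega>. \<alpha> u \<omega>)"
    (* the signal *)
    and X_measurable: "measurable_process T P borel X"
    and X_markov: "markov_process T P (natural_filtration P borel X) borel X"
    and XS_markov: "markov_process T P F (borel \<Otimes>\<^sub>M borel) (\<lambda>t \<omega>. (X t \<omega>, S t \<omega>))"
    and FS_eq: "FS = usual_augmentation T P (natural_filtration P borel S)"
    (* further standing assumptions *)
    and \<rho>_nonneg: "\<And>u. 0 \<le> u \<Longrightarrow> 0 \<le> \<rho> u"
    and \<rho>_0: "(\<rho> \<longlongrightarrow> 0) (at_right 0)"
    and A_\<rho>: "AE \<omega> in P. \<forall>s\<in>{0..T}. \<forall>t\<in>{s..T}. A t \<omega> - A s \<omega> \<le> \<rho> (t - s)"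
    and k_nonneg: "0 \<le> k"
    and \<alpha>_bound: "AE (t, \<omega>) in doleans_measure T P A. \<bar>\<alpha> t \<omega>\<bar> \<le> k * S t \<omega>"
    and jumps: "AE \<omega> in P. \<forall>t\<in>{0..T}. 1 - \<alpha> t \<omega> * jump M t \<omega> > 0"
    and M_decomposition: "martingale_decomposition T P F M Mc Md"
    and Mc_qv: "predictable_qv T P F Mc Ac"
    and Md_qv: "predictable_qv T P F Md Ad"
    and exp_moment: "integrable P (\<lambda>\<omega>. exp (
          1/2 * (LINT t:{0<..T}|path_measure T Ac \<omega>. (\<alpha> t \<omega>)\<^sup>2) +
          (LINT t:{0<..T}|path_measure T Ad \<omega>. (\<alpha> t \<omega>)\<^sup>2)))"
    (* the minimal martingale measure *)
    and I_integral: "ito_integral T P F M A \<alpha> I"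
    and L_exponential: "doleans_dade_exponential T P F (\<lambda>t \<omega>. - I t \<omega>) L"
    and L_sq: "square_integrable_process T P L"
    and Pstar_prob: "prob_space Pstar"
    and Pstar_sets: "sets Pstar = sets P"
    and Pstar_density: "density_process T P F Pstar L"
    (* the filter and the claim *)
    and \<pi>_filter: "filter_process T P FS X S \<pi>"
    and H_measurable: "H \<in> borel_measurable (txs_space T)"
    and \<xi>_eq: "\<xi> = (\<lambda>\<omega>. H (T, X T \<omega>, S T \<omega>))"
    and \<xi>_sq: "integrable P (\<lambda>\<omega>. (\<xi> \<omega>)\<^sup>2)"
    and o\<xi>_eq: "o\<xi> = real_cond_exp P (FS T) \<xi>"
    and o\<xi>_sq: "integrable Pstar (\<lambda>\<omega>. (o\<xi> \<omega>)\<^sup>2)"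
    and S_sq_star: "square_integrable_process T Pstar S"
    and XS\<pi>_markov: "markov_process T Pstar F (borel \<Otimes>\<^sub>M (borel \<Otimes>\<^sub>M weak_borel))
          (\<lambda>t \<omega>. (X t \<omega>, S t \<omega>, \<pi> t \<omega>))"
    and V_eq: "V = (\<lambda>t. real_cond_exp Pstar (FS t) o\<xi>)"
  shows
    "(\<exists>g \<in> borel_measurable (txsp_space T).
        \<forall>t\<in>{0..T}. AE \<omega> in Pstar.
          g (t, X t \<omega>, S t \<omega>, \<pi> t \<omega>) = real_cond_exp Pstar (F t) (filter_apply S \<pi> H T) \<omega>)
     \<and>
     (\<forall>g \<in> borel_measurable (txsp_space T).
        (\<forall>t\<in>{0..T}. AE \<omega> in Pstar.
          g (t, X t \<omega>, S t \<omega>, \<pi> t \<omega>) = real_cond_exp Pstar (F t) (filter_apply S \<pi> H T) \<omega>)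
        \<longrightarrow> (\<forall>t\<in>{0..T}. AE \<omega> in Pstar.
               V t \<omega> = real_cond_exp Pstar (FS t) (\<lambda>\<omega>. g (t, X t \<omega>, S t \<omega>, \<pi> t \<omega>)) \<omega>))"
proof -
  interpret P: prob_space P by (rule prob)
  interpret Q: prob_space Pstar by (rule Pstar_prob)
  have space_eq: "space Pstar = space P" using Pstar_sets by (rule sets_eq_imp_space_eq)
  note [measurable_cong] = Pstar_sets
  let ?Time = "restrict_space borel {0..T} :: real measure"
  let ?E = "borel \<Otimes>\<^sub>M (borel \<Otimes>\<^sub>M weak_borel) :: (real \<times> real \<times> real measure) measure"
  define Z where "Z t \<omega> = (X t \<omega>, S t \<omega>, \<pi> t \<omega>)" for t \<omega>
  define Y where "Y = filter_apply S \<pi> H T"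
  have T: "T \<in> {0..T}" using T_pos by simp

  have FP: "subalgebra P (F t)" if "t \<in> {0..T}" for t
    using usual that by (auto simp: usual_conditions_def filtration_on_def)
  have FQ: "subalgebra Pstar (F t)" if "t \<in> {0..T}" for t
    using FP[OF that] space_eq Pstar_sets by (simp add: subalgebra_def)
  have S_adapted: "adapted T F borel S" and S_cadlag: "cadlag T P S"
    using S_semimartingale by (auto simp: semimartingale_def)
  have FSF: "subalgebra (F t) (FS t)" if "t \<in> {0..T}" for t
    unfolding FS_eq using subalgebra_usual_augmentation[OF usual S_adapted] that by simp

  \<comment> \<open>Fubini in the time variable needs all three components jointly measurable; for
    \<open>S\<close> this comes from right-continuous paths.\<close>
  have S_meas: "measurable_process T P borel S"
    using S_sq T_pos by (intro cadlag_measurable_process S_cadlag) (auto simp: square_integrable_process_def)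
  have joint: "case_prod X \<in> ?Time \<Otimes>\<^sub>M Pstar \<rightarrow>\<^sub>M borel" "case_prod S \<in> ?Time \<Otimes>\<^sub>M Pstar \<rightarrow>\<^sub>M borel"
      "case_prod \<pi> \<in> ?Time \<Otimes>\<^sub>M Pstar \<rightarrow>\<^sub>M weak_borel"
    using X_measurable S_meas \<pi>_filter by (auto simp: measurable_process_def filter_process_def cong: measurable_cong_sets)
  have "(\<lambda>p. (case_prod X p, case_prod S p, case_prod \<pi> p)) \<in> ?Time \<Otimes>\<^sub>M Pstar \<rightarrow>\<^sub>M ?E"
    using joint by (intro measurable_Pair)
  then have Z_joint: "case_prod Z \<in> ?Time \<Otimes>\<^sub>M Pstar \<rightarrow>\<^sub>M ?E"
    by (simp add: Z_def[abs_def] case_prod_beta)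
  have Z_meas: "Z t \<in> Pstar \<rightarrow>\<^sub>M ?E" if "t \<in> {0..T}" for t
    using measurable_Pair2[OF Z_joint, of t] that by (simp add: space_restrict_space)
  have XS_meas [measurable]: "X T \<in> borel_measurable P" "S T \<in> borel_measurable P"
    using measurable_Pair2[OF joint(1), of T] measurable_Pair2[OF joint(2), of T] T
    by (simp_all add: space_restrict_space cong: measurable_cong_sets)

  \<comment> \<open>Since \<open>F T\<close> contains every measurable set, the density at
    \<open>T\<close> alone carries P-null sets to \<open>Pstar\<close>-null sets.\<close>
  have "absolutely_continuous (restr_to_subalg P (F T)) (restr_to_subalg Pstar (F T))"
  proof -
    have "L T \<in> borel_measurable (F T)"
      using L_sq T F_T FP[OF T]
      by (simp add: square_integrable_process_def cong: measurable_cong_sets)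
    then have "(\<lambda>\<omega>. ennreal (L T \<omega>)) \<in> borel_measurable (restr_to_subalg P (F T))"
      using sets_restr_to_subalg[OF FP[OF T]] by (simp cong: measurable_cong_sets)
    then show ?thesis
      using Pstar_density T by (simp add: density_process_def absolutely_continuousI_density)
  qed
  then have ac: "absolutely_continuous P Pstar"
    using null_sets_restr_to_subalg[OF FP[OF T]] null_sets_restr_to_subalg[OF FQ[OF T]] F_T Pstar_sets
    by (auto simp: absolutely_continuous_def)

  text \<open>The filter formula needs integrability at every time, which is only known for \<open>H\<close> at time
    \<open>T\<close>; so \<open>H\<close> is cut off before \<open>T\<close>.\<close>
  define H' where "H' p = (if fst p = T then H p else 0)" for p
  have H'_meas: "H' \<in> borel_measurable (txs_space T)"
  proof -
    have "fst \<in> txs_space T \<rightarrow>\<^sub>M (borel :: real measure)"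
      by (rule measurable_fst'') (rule measurable_restrict_space1, simp)
    then have "{p \<in> space (txs_space T). fst p = T} \<in> sets (txs_space T)" by measurable
    then show ?thesis unfolding H'_def[abs_def] using H_measurable by (intro measurable_If) auto
  qed
  have "(\<lambda>\<omega>. (T, X T \<omega>, S T \<omega>)) \<in> P \<rightarrow>\<^sub>M txs_space T"
    using T by (intro measurable_Pair) (auto simp: space_restrict_space)
  then have \<xi>_meas: "\<xi> \<in> borel_measurable P"
    unfolding \<xi>_eq by (rule measurable_compose) (rule H_measurable)
  then have "integrable P \<xi>"
    using \<xi>_sq by (intro P.sq_integrable_integrable) (simp add: sq_integrable_def)
  then have "integrable P (\<lambda>\<omega>. H' (t, X t \<omega>, S t \<omega>))" for t
    by (cases "t = T") (simp_all add: H'_def \<xi>_eq)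
  then have "AE \<omega> in P. real_cond_exp P (FS T) (\<lambda>\<omega>. H' (T, X T \<omega>, S T \<omega>)) \<omega> = filter_apply S \<pi> H' T \<omega>"
    using \<pi>_filter H'_meas T unfolding filter_process_def by blast
  then have "AE \<omega> in P. o\<xi> \<omega> = Y \<omega>"
    by (simp add: H'_def o\<xi>_eq \<xi>_eq Y_def filter_apply_def)
  then have o\<xi>_Y: "AE \<omega> in Pstar. o\<xi> \<omega> = Y \<omega>"
    using absolutely_continuous_AE[OF Pstar_sets ac] by simp

  \<comment> \<open>The Markov property concerns functions of the later state, so \<pi>_T(H) is
    written as a deterministic function of \<open>Z T\<close>, in which only S_T and \<pi>_T
    enter.\<close>
  define h where "h = (\<lambda>(x :: real, s, p). \<integral>x'. H (T, x', s) \<partial>p)"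
  have h_meas: "h \<in> borel_measurable ?E"
  proof -
    have "(\<lambda>q. \<integral>x'. (\<lambda>(z, x'). H (T, x', fst (snd z))) (q, x') \<partial>snd (snd q)) \<in> borel_measurable ?E"
    proof (rule borel_measurable_kernel_integral)
      have "(\<lambda>w. (T, snd w, fst (snd (fst w)))) \<in> ?E \<Otimes>\<^sub>M borel \<rightarrow>\<^sub>M txs_space T"
        using T by (intro measurable_Pair) (auto simp: space_restrict_space)
      from measurable_compose[OF this H_measurable]
      show "(\<lambda>(z, x'). H (T, x', fst (snd z))) \<in> borel_measurable (?E \<Otimes>\<^sub>M borel)"
        by (simp add: case_prod_beta)
      show "(\<lambda>q. snd (snd q)) \<in> ?E \<rightarrow>\<^sub>M subprob_algebra borel"
        using measurable_weak_borel_prob_algebra[THEN measurable_prob_algebraD]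
        by (rule measurable_compose[rotated]) measurable
    qed
    then show ?thesis by (simp add: h_def case_prod_beta)
  qed
  have Y_h: "Y = (\<lambda>\<omega>. h (Z T \<omega>))"
    by (auto simp: Y_def h_def Z_def filter_apply_def)
  have Y_meas [measurable]: "Y \<in> borel_measurable Pstar"
    unfolding Y_h using Z_meas[OF T] h_meas by (rule measurable_compose)
  have o\<xi>_meas [measurable]: "o\<xi> \<in> borel_measurable Pstar"
    unfolding o\<xi>_eq by (simp cong: measurable_cong_sets)
  have Y_sq: "sq_integrable Pstar Y"
  proof -
    have "integrable Pstar (\<lambda>\<omega>. (Y \<omega>)\<^sup>2) \<longleftrightarrow> integrable Pstar (\<lambda>\<omega>. (o\<xi> \<omega>)\<^sup>2)"
      using o\<xi>_Y by (intro integrable_cong_AE) auto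
    with o\<xi>_sq show ?thesis by (simp add: sq_integrable_def)
  qed
  have Y_int: "integrable Pstar Y" by (rule Q.sq_integrable_integrable[OF Y_sq])

  have markov: "AE \<omega> in Pstar. real_cond_exp Pstar (F t) Y \<omega>
      = real_cond_exp Pstar (vimage_algebra (space Pstar) (Z t) ?E) Y \<omega>" if t: "t \<in> {0..T}" for t
  proof (rule Q.real_cond_exp_eq_if_truncations[OF FQ[OF t] _ Y_int])
    have "Z t \<in> F t \<rightarrow>\<^sub>M ?E"
      using XS\<pi>_markov t by (simp add: markov_process_def adapted_def Z_def[abs_def])
    then show "subalgebra (F t) (vimage_algebra (space Pstar) (Z t) ?E)"
      using subalgebra_vimage[of "Z t" "F t"] FQ[OF t] by (simp add: subalgebra_def)
    fix n :: nat
    \<comment> \<open>Truncating \<open>Y\<close> amounts to truncating \<open>h\<close>, which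
      gives a bounded function of the state.\<close>
    let ?h = "\<lambda>z. max (- real n) (min (real n) (h z))"
    have "?h \<in> borel_measurable ?E" using h_meas by measurable
    moreover have "bounded (?h ` space ?E)" by (auto simp: bounded_iff intro!: exI[of _ "real n"])
    ultimately show "AE \<omega> in Pstar. real_cond_exp Pstar (F t) (\<lambda>\<omega>. max (- real n) (min (real n) (Y \<omega>))) \<omega>
        = real_cond_exp Pstar (vimage_algebra (space Pstar) (Z t) ?E)
            (\<lambda>\<omega>. max (- real n) (min (real n) (Y \<omega>))) \<omega>"
      using XS\<pi>_markov t T unfolding markov_process_def Y_h Z_def[abs_def] by fastforce
  qed

  have "countably_generated weak_borel"
    unfolding countably_generated_def space_weak_borel
    using countable_weak_subbase sets_weak_borel
    by (intro exI[of _ weak_subbase]) (auto simp: weak_subbase_def)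
  then have cg: "countably_generated ?E"
    by (intro countably_generated_pair countably_generated_borel)
  obtain g where g: "g \<in> borel_measurable (?Time \<Otimes>\<^sub>M ?E)"
    "\<forall>t\<in>space ?Time. AE \<omega> in Pstar. g (t, Z t \<omega>)
      = real_cond_exp Pstar (vimage_algebra (space Pstar) (Z t) ?E) Y \<omega>"
    using Q.jointly_measurable_cond_exp[OF cg Z_joint Y_sq] by (elim bexE)
  have "AE \<omega> in Pstar. g (t, Z t \<omega>) = real_cond_exp Pstar (F t) Y \<omega>" if t: "t \<in> {0..T}" for t
  proof -
    have "t \<in> space ?Time" using t by (simp add: space_restrict_space)
    from bspec[OF g(2) this] markov[OF t] show ?thesis by eventually_elim simp
  qed
  with g(1) have ex: "\<exists>g \<in> borel_measurable (txsp_space T). \<forall>t\<in>{0..T}. AE \<omega> in Pstar.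
      g (t, Z t \<omega>) = real_cond_exp Pstar (F t) Y \<omega>" by blast

  have rep: "AE \<omega> in Pstar. V t \<omega> = real_cond_exp Pstar (FS t) (\<lambda>\<omega>. g (t, Z t \<omega>)) \<omega>"
    if g: "g \<in> borel_measurable (txsp_space T)" and t: "t \<in> {0..T}"
      and eq: "AE \<omega> in Pstar. g (t, Z t \<omega>) = real_cond_exp Pstar (F t) Y \<omega>" for g t
  proof -
    have FSQ: "subalgebra Pstar (FS t)" using FQ[OF t] FSF[OF t] by (auto simp: subalgebra_def)
    interpret FS: finite_measure_subalgebra Pstar "FS t" by unfold_locales (rule FSQ)
    have "(\<lambda>\<omega>. (t, Z t \<omega>)) \<in> Pstar \<rightarrow>\<^sub>M txsp_space T"
      using t Z_meas[OF t] by (intro measurable_Pair) (auto simp: space_restrict_space)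
    then have "(\<lambda>\<omega>. g (t, Z t \<omega>)) \<in> borel_measurable Pstar" using g by (rule measurable_compose)
    then have "AE \<omega> in Pstar. real_cond_exp Pstar (FS t) (\<lambda>\<omega>. g (t, Z t \<omega>)) \<omega>
        = real_cond_exp Pstar (FS t) (real_cond_exp Pstar (F t) Y) \<omega>"
      using eq by (intro FS.real_cond_exp_cong) auto
    moreover have "AE \<omega> in Pstar. real_cond_exp Pstar (FS t) (real_cond_exp Pstar (F t) Y) \<omega>
        = real_cond_exp Pstar (FS t) Y \<omega>"
      by (rule FS.real_cond_exp_nested_subalg[OF FQ[OF t] FSF[OF t] Y_int])
    moreover have "AE \<omega> in Pstar. real_cond_exp Pstar (FS t) o\<xi> \<omega> = real_cond_exp Pstar (FS t) Y \<omega>"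
      using o\<xi>_Y by (intro FS.real_cond_exp_cong) auto
    ultimately show ?thesis unfolding V_eq by eventually_elim simp
  qed
  show ?thesis
    using ex rep unfolding Z_def Y_def by blast
qed

end
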